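(* Let $S$ be a left reversible discrete semigroup. Let $C$ be a nonempty L-embedded convex subset of a Banach space $E$, and let $\{T_s : s\in S\}$ be a representation of $S$ on $C$ by norm nonexpansive mappings such that each $T_s$ ($s\in S$) is weak-weak continuous on every weakly compact $S$-invariant convex subset of $C$. If $C$ contains a nonempty bounded subset $B$ such that $T_s(B)=B$ for all $s\in S$, then $C$ contains a common fixed point for $S$, that is, there is $x\in C$ with $T_s(x)=x$ for all $s\in S$.
   Context: A discrete semigroup $S$ is left reversible if $sS\cap tS\neq\emptyset$ for all $s,t\in S$. A representation of $S$ on a set $C$ is a family $\{T_s:s\in S\}$ of mappings $T_s:C\to C$ with $T_{st}(x)=T_s(T_t x)$ for all $s,t\in S$, $x\in C$. It is norm nonexpansive if $\|T_sx-T_sy\|\le\|x-y\|$ for all $s\in S$, $x,y\in C$. A subset $M\subset C$ is $S$-invariant if $T_s(M)\subset M$ for all $s\in S$. L-embedded set: let $C$ be a nonempty subset of a Banach space $E$, regard $E\subset E^{**}$ canonically, and let $\overline{C}^{\mathrm{wk*}}$ be the weak* closure of $C$ in $E^{**}$. $C$ is L-embedded if there is a subspace $E_s$ of $E^{**}$ such that $E+E_s=E\oplus_1E_s$ in $E^{**}$ (i.e. the sum is direct and $\|x+\xi\|=\|x\|+\|\xi\|$ for $x\in E$, $\xi\in E_s$) and $\overline{C}^{\mathrm{wk*}}\subset C\oplus_1E_s$, i.e. each $u\in\overline{C}^{\mathrm{wk*}}$ can be written $u=c+\xi$ with $c\in C$, $\xi\in E_s$. *)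

theory Defs
  imports "HOL-Analysis.Analysis"
begin

definition left_reversible :: "'s::semigroup_mult itself \<Rightarrow> bool" where
  "left_reversible _ \<longleftrightarrow> (\<forall>s t :: 's. range (\<lambda>u. s * u) \<inter> range (\<lambda>u. t * u) \<noteq> {})"

definition representation_on :: "('s::semigroup_mult \<Rightarrow> 'a \<Rightarrow> 'a) \<Rightarrow> 'a set \<Rightarrow> bool" where
  "representation_on T C \<longleftrightarrow>
     (\<forall>s. T s ` C \<subseteq> C) \<and> (\<forall>s t. \<forall>x\<in>C. T (s * t) x = T s (T t x))"

definition norm_nonexpansive_on ::
    "('s \<Rightarrow> 'a::real_normed_vector \<Rightarrow> 'a) \<Rightarrow> 'a set \<Rightarrow> bool" where
  "norm_nonexpansive_on T C \<longleftrightarrow> (\<forall>s. \<forall>x\<in>C. \<forall>y\<in>C. norm (T s x - T s y) \<le> norm (x - y))"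

definition S_invariant :: "('s \<Rightarrow> 'a \<Rightarrow> 'a) \<Rightarrow> 'a set \<Rightarrow> bool" where
  "S_invariant T M \<longleftrightarrow> (\<forall>s. T s ` M \<subseteq> M)"

type_synonym 'a dual = "'a \<Rightarrow>\<^sub>L real"
type_synonym 'a bidual = "('a \<Rightarrow>\<^sub>L real) \<Rightarrow>\<^sub>L real"

text \<open>The coarsest topology making every continuous linear functional continuous: the initial
  topology of the evaluation map into the product space of all functions on the dual.\<close>

definition weak_topology :: "'a::real_normed_vector topology" where
  "weak_topology = pullback_topology UNIV (\<lambda>x (f :: 'a dual). blinfun_apply f x) euclidean"

text \<open>For scalar-valued operators, i.e. on a dual space, the topology of pointwise convergence
  is the weak* topology.\<close>

abbreviation weak_star_topology :: "('b::real_normed_vector) dual topology" where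
  "weak_star_topology \<equiv> strong_operator_topology"

definition canonical_embedding :: "'a::real_normed_vector \<Rightarrow> 'a bidual" where
  "canonical_embedding x = Blinfun (\<lambda>f. blinfun_apply f x)"

lemma canonical_embedding_apply [simp]:
  "blinfun_apply (canonical_embedding x) f = blinfun_apply f x"
  by (simp add: canonical_embedding_def bounded_linear_Blinfun_apply blinfun.bounded_linear_left)

definition L_embedded :: "'a::banach set \<Rightarrow> bool" where
  "L_embedded C \<longleftrightarrow> C \<noteq> {} \<and>
     (\<exists>Es :: 'a bidual set. subspace Es \<and>
        range canonical_embedding \<inter> Es = {0} \<and>
        (\<forall>x. \<forall>\<xi>\<in>Es. norm (canonical_embedding x + \<xi>) = norm x + norm \<xi>) \<and>
        (\<forall>u \<in> weak_star_topology closure_of (canonical_embedding ` C).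
           \<exists>c\<in>C. \<exists>\<xi>\<in>Es. u = canonical_embedding c + \<xi>))"

lemma topspace_weak_topology [simp]: "topspace weak_topology = UNIV"
  by (simp add: weak_topology_def topspace_pullback_topology)

lemma continuous_map_weak_topology_iff:
  "continuous_map X (weak_topology :: 'a::real_normed_vector topology) g \<longleftrightarrow>
     (\<forall>f :: 'a dual. continuous_map X euclideanreal (\<lambda>x. blinfun_apply f (g x)))"
proof
  assume g: "continuous_map X weak_topology g"
  have "continuous_map weak_topology euclidean (\<lambda>(x::'a) (f :: 'a dual). blinfun_apply f x)"
    unfolding weak_topology_def
    using continuous_map_pullback[of euclidean euclidean "\<lambda>h. h" UNIV
        "\<lambda>(x::'a) (f :: 'a dual). blinfun_apply f x"]
    by (simp add: comp_def)
  from continuous_map_compose[OF g this]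
  have "continuous_map X (product_topology (\<lambda>_. euclideanreal) UNIV)
          (\<lambda>x (f :: 'a dual). blinfun_apply f (g x))"
    by (simp add: comp_def euclidean_product_topology)
  then show "\<forall>f :: 'a dual. continuous_map X euclideanreal (\<lambda>x. blinfun_apply f (g x))"
    by (simp add: continuous_map_componentwise_UNIV)
next
  assume "\<forall>f :: 'a dual. continuous_map X euclideanreal (\<lambda>x. blinfun_apply f (g x))"
  then have "continuous_map X (product_topology (\<lambda>_. euclideanreal) UNIV)
          (\<lambda>x (f :: 'a dual). blinfun_apply f (g x))"
    by (simp add: continuous_map_componentwise_UNIV)
  then show "continuous_map X weak_topology g"
    unfolding weak_topology_def
    by (intro continuous_map_pullback') (auto simp: comp_def euclidean_product_topology)
qed

end

theory Submission
  imports Defs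
begin

text \<open>
  The points of \<open>C\<close> that realise the Chebyshev radius of \<open>B\<close> form a convex invariant set, and
  L-embeddedness makes it nonempty and weakly compact: a weak* cluster point \<open>c + \<xi>\<close> of almost optimal
  points satisfies \<open>\<parallel>c - b\<parallel> + \<parallel>\<xi>\<parallel> \<le> r\<close> for all \<open>b \<in> B\<close>, which forces \<open>\<xi> = 0\<close>.

  On a weakly compact convex set the sets of fixed points are weakly closed, so a countable left
  reversible semigroup may be assumed, acting on a norm separable set \<open>K\<close> that is minimal among the
  weakly compact convex invariant sets. Call \<open>Z \<subseteq> K\<close> expanded if it is weakly closed and
  \<open>Z \<subseteq> T\<^sub>s Z\<close> for all \<open>s\<close>; by left reversibility \<open>\<Inter>\<^sub>s T\<^sub>s K\<close> is nonempty and expanded. Take a minimal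
  nonempty expanded \<open>Z\<close>. Removing from \<open>Z\<close> all relatively weakly open sets that are covered by
  finitely many \<open>e\<close>-balls leaves an expanded set, since the maps are nonexpansive, and a proper subset,
  by Baire's theorem and separability; hence it leaves the empty set, and \<open>Z\<close> is norm compact. Left
  reversibility makes \<open>\<Union>\<^sub>s T\<^sub>s Z\<close> a directed union of sets that are covered by the same number of
  \<open>e\<close>-balls, so its closure \<open>Y\<close> is norm compact, and \<open>T\<^sub>s Y = Y\<close>. If \<open>Y\<close> had two points, the
  average of a finite net of \<open>Y\<close> would be nearer to all of \<open>Y\<close> than its diameter, and the points of \<open>K\<close>
  with this property would contradict the minimality of \<open>K\<close>.
\<close>

section \<open>Hahn--Banach separation and the weak topology\<close>

definition sublinear :: "('a::real_vector \<Rightarrow> real) \<Rightarrow> bool" where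
  "sublinear p \<longleftrightarrow> (\<forall>x y. p (x + y) \<le> p x + p y) \<and> (\<forall>t x. 0 \<le> t \<longrightarrow> p (t *\<^sub>R x) \<le> t * p x)"

lemma sublinear_add: "sublinear p \<Longrightarrow> p (x + y) \<le> p x + p y"
  by (simp add: sublinear_def)

lemma sublinear_zero:
  assumes "sublinear p" shows "p 0 = 0"
proof -
  have "p 0 \<le> p 0 + p 0" "p (0 *\<^sub>R 0) \<le> 0 * p 0"
    using assms sublinear_add[of p 0 0] by (auto simp: sublinear_def)
  then show ?thesis by simp
qed

text \<open>Applying the defining inequality to \<open>inverse t\<close> and
  \<open>t *\<^sub>R x\<close> reverses it. The definition can therefore ask for the inequality
  alone, which is what is easy to check for infima.\<close>

lemma sublinear_scaleR:
  assumes "sublinear p" "0 \<le> t" shows "p (t *\<^sub>R x) = t * p x"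
proof (cases "t = 0")
  case True
  then show ?thesis by (simp add: sublinear_zero assms)
next
  case False
  then have "0 < t" using assms by simp
  have "p (inverse t *\<^sub>R (t *\<^sub>R x)) \<le> inverse t * p (t *\<^sub>R x)"
    using assms unfolding sublinear_def by (metis inverse_nonnegative_iff_nonnegative)
  then have "t * p x \<le> p (t *\<^sub>R x)"
    using \<open>0 < t\<close> by (simp add: field_simps)
  then show ?thesis using assms unfolding sublinear_def by (metis antisym)
qed

lemma sublinear_minus_ge:
  assumes "sublinear p" shows "- p (- x) \<le> p x"
  using sublinear_add[OF assms, of x "- x"] sublinear_zero[OF assms] by simp

text \<open>Minimality is tested against \<open>x \<mapsto> inf {q (x + t y) - t q y | t \<ge> 0}\<close>, which is sublinear and
  at most \<open>q\<close>.\<close>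

lemma minimal_sublinear_imp_linear:
  fixes q :: "'a::real_vector \<Rightarrow> real"
  assumes q: "sublinear q"
    and minimal: "\<And>q'. sublinear q' \<Longrightarrow> (\<And>x. q' x \<le> q x) \<Longrightarrow> q' = q"
  shows "linear q"
proof -
  have super: "q x + q y \<le> q (x + y)" for x y
  proof -
    define g where "g = (\<lambda>x t. q (x + t *\<^sub>R y) - t * q y)"
    define q' where "q' = (\<lambda>x. INF t\<in>{0..}. g x t)"
    \<comment> \<open>This bound keeps the infimum that defines \<open>q'\<close> finite.\<close>
    have lower: "- q (- x) \<le> g x t" if "0 \<le> t" for x t
    proof -
      have "q (t *\<^sub>R y) \<le> q (x + t *\<^sub>R y) + q (- x)"
        using sublinear_add[OF q, of "x + t *\<^sub>R y" "- x"] by simp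
      then show ?thesis using that by (simp add: g_def sublinear_scaleR[OF q])
    qed
    have bdd: "bdd_below (g x ` {0..})" for x
      using lower by (intro bdd_belowI[of _ "- q (- x)"]) auto
    have le: "q' x \<le> g x t" if "0 \<le> t" for x t
      unfolding q'_def by (rule cINF_lower[OF bdd]) (use that in auto)
    have ge: "c \<le> q' x" if "\<And>t. 0 \<le> t \<Longrightarrow> c \<le> g x t" for x c
      unfolding q'_def by (rule cINF_greatest) (use that in auto)
    have "sublinear q'"
      unfolding sublinear_def
    proof (intro conjI allI impI)
      fix x1 x2
      \<comment> \<open>Parameters add up: \<open>t1 + t2\<close> serves for \<open>x1 + x2\<close>.
        Taking the infimum over \<open>t2\<close> and then over \<open>t1\<close> gives
        subadditivity.\<close>
      have "q' (x1 + x2) - g x1 t1 \<le> g x2 t2" if "0 \<le> t1" "0 \<le> t2" for t1 t2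
      proof -
        have "q' (x1 + x2) \<le> g (x1 + x2) (t1 + t2)" using that by (intro le) simp
        also have "\<dots> \<le> g x1 t1 + g x2 t2"
          using sublinear_add[OF q, of "x1 + t1 *\<^sub>R y" "x2 + t2 *\<^sub>R y"]
          by (simp add: g_def algebra_simps)
        finally show ?thesis by simp
      qed
      then have "q' (x1 + x2) - q' x2 \<le> g x1 t1" if "0 \<le> t1" for t1
        using ge[of "q' (x1 + x2) - g x1 t1" x2] that by fastforce
      then show "q' (x1 + x2) \<le> q' x1 + q' x2"
        using ge[of "q' (x1 + x2) - q' x2" x1] by fastforce
    next
      fix s :: real and x assume "0 \<le> s"
      show "q' (s *\<^sub>R x) \<le> s * q' x"
      proof (cases "s = 0")
        case True
        then show ?thesis using le[of 0 0] by (simp add: g_def sublinear_zero[OF q])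
      next
        case False
        then have "0 < s" using \<open>0 \<le> s\<close> by simp
        have "q' (s *\<^sub>R x) / s \<le> g x t" if "0 \<le> t" for t
        proof -
          have "q' (s *\<^sub>R x) \<le> g (s *\<^sub>R x) (s * t)" using \<open>0 < s\<close> that by (intro le) simp
          also have "\<dots> = s * g x t"
            using sublinear_scaleR[OF q, of s "x + t *\<^sub>R y"] \<open>0 < s\<close>
            by (simp add: g_def algebra_simps)
          finally show ?thesis using \<open>0 < s\<close> by (simp add: field_simps)
        qed
        then show ?thesis using ge[of "q' (s *\<^sub>R x) / s" x] \<open>0 < s\<close> by (simp add: field_simps)
      qed
    qed
    moreover have "q' x \<le> q x" for x using le[of 0 x] by (simp add: g_def)
    ultimately have "q' = q" by (rule minimal)
    \<comment> \<open>Minimality identifies \<open>q'\<close> with \<open>q\<close>, so its bound at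
      \<open>t = 1\<close> is superadditivity of \<open>q\<close>.\<close>
    then show ?thesis using le[of 1 x] by (simp add: g_def)
  qed
  then have add: "q (x + y) = q x + q y" for x y
    using sublinear_add[OF q] by (meson antisym)
  have neg: "q (- x) = - q x" for x
    using add[of x "- x"] sublinear_zero[OF q] by simp
  have "q (t *\<^sub>R x) = t *\<^sub>R q x" for t x
  proof (cases "0 \<le> t")
    case True
    then show ?thesis by (simp add: sublinear_scaleR[OF q])
  next
    case False
    then have "q (- ((- t) *\<^sub>R x)) = - ((- t) * q x)"
      unfolding neg by (subst sublinear_scaleR[OF q]) auto
    then show ?thesis by simp
  qed
  then show ?thesis using add by (intro linearI)
qed

text \<open>Zorn's lemma gives a minimal sublinear functional below \<open>p\<close>, and minimal
  ones are linear. It applies because the pointwise infimum of a chain is again sublinear.\<close>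

theorem Hahn_Banach_sublinear:
  fixes p :: "'a::real_vector \<Rightarrow> real"
  assumes p: "sublinear p"
  obtains f where "linear f" "\<And>x. f x \<le> p x"
proof -
  define A where "A = {q. sublinear q \<and> q \<le> p}"
  \<comment> \<open>The order is reversed, so that a maximal element is a minimal
    functional.\<close>
  define R where "R = relation_of (\<lambda>q q'. q' \<le> q) A"
  have po: "partial_order_on A R"
    unfolding R_def partial_order_on_def preorder_on_def relation_of_def refl_on_def
      trans_def antisym_def by auto
  have lower: "- p (- x) \<le> q x" if "q \<in> A" for q x
  proof -
    have "q (- x) \<le> p (- x)" using that by (simp add: A_def le_fun_def)
    then show ?thesis using sublinear_minus_ge[of q x] that by (simp add: A_def)
  qed
  have "\<exists>u\<in>A. \<forall>q\<in>Ch. u \<le> q" if Ch: "Ch \<in> Chains R" for Ch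
  proof (cases "Ch = {}")
    case True
    then show ?thesis using p by (auto simp: A_def)
  next
    case False
    have sub: "q \<in> A" if "q \<in> Ch" for q
      using Ch that unfolding Chains_def R_def relation_of_def by auto
    have comp: "q \<le> q' \<or> q' \<le> q" if "q \<in> Ch" "q' \<in> Ch" for q q'
      using Ch that unfolding Chains_def R_def relation_of_def by auto
    define u where "u = (\<lambda>x. INF q\<in>Ch. q x)"
    have le: "u x \<le> q x" if "q \<in> Ch" for q x
      unfolding u_def using that lower sub
      by (intro cINF_lower bdd_belowI[of _ "- p (- x)"]) auto
    have ge: "c \<le> u x" if "\<And>q. q \<in> Ch \<Longrightarrow> c \<le> q x" for x c
      unfolding u_def using False that by (intro cINF_greatest) auto
    have "sublinear u"
      unfolding sublinear_def
    proof (intro conjI allI impI)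
      fix x y
      have *: "u (x + y) - q1 x \<le> q2 y" if q12: "q1 \<in> Ch" "q2 \<in> Ch" for q1 q2
      proof -
        \<comment> \<open>In a chain the smaller of \<open>q1\<close> and \<open>q2\<close> lies
          below both, so its subadditivity suffices.\<close>
        obtain q where "q \<in> Ch" "q \<le> q1" "q \<le> q2" using comp[OF q12] q12 by blast
        then have "u (x + y) \<le> q (x + y)" "q (x + y) \<le> q x + q y" "q x \<le> q1 x" "q y \<le> q2 y"
          using le sub sublinear_add[of q x y] by (auto simp: A_def le_fun_def)
        then show ?thesis by linarith
      qed
      have "u (x + y) - u y \<le> q1 x" if "q1 \<in> Ch" for q1
        using ge[of "u (x + y) - q1 x" y] * that by fastforce
      then show "u (x + y) \<le> u x + u y" using ge[of "u (x + y) - u y" x] by fastforce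
    next
      fix t :: real and x assume "0 \<le> t"
      have *: "u (t *\<^sub>R x) \<le> t * q x" if "q \<in> Ch" for q
        using le[OF that, of "t *\<^sub>R x"] sub[OF that] \<open>0 \<le> t\<close> sublinear_scaleR[of q t x]
        by (simp add: A_def)
      show "u (t *\<^sub>R x) \<le> t * u x"
      proof (cases "t = 0")
        case True
        then show ?thesis using * False by fastforce
      next
        case False
        then have "0 < t" using \<open>0 \<le> t\<close> by simp
        then have "u (t *\<^sub>R x) / t \<le> u x"
          using * by (intro ge) (simp add: field_simps)
        then show ?thesis using \<open>0 < t\<close> by (simp add: field_simps)
      qed
    qed
    moreover have "u \<le> p"
      using False le sub by (fastforce simp: A_def le_fun_def intro: order_trans)
    ultimately show ?thesis using le by (auto simp: A_def le_fun_def)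
  qed
  then obtain q where q: "q \<in> A" and min: "\<And>q'. q' \<in> A \<Longrightarrow> q' \<le> q \<Longrightarrow> q' = q"
    using predicate_Zorn[of A "\<lambda>q q'. q' \<le> q"] po unfolding R_def by blast
  have "linear q"
  proof (rule minimal_sublinear_imp_linear)
    show "sublinear q" using q by (simp add: A_def)
    fix q' assume "sublinear q'" "\<And>x. q' x \<le> q x"
    then show "q' = q" using q by (intro min) (auto simp: A_def le_fun_def intro: order_trans)
  qed
  moreover have "q x \<le> p x" for x using q by (simp add: A_def le_fun_def)
  ultimately show ?thesis by (rule that)
qed

text \<open>Hahn--Banach is applied to a sublinear \<open>p\<close> below the norm, which makes the
  functional continuous. The distance from \<open>x\<close> to \<open>C\<close> is built into
  \<open>p\<close>, and convexity of \<open>C\<close> makes \<open>p\<close> subadditive.\<close>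

lemma separating_functional_closed_convex:
  fixes C :: "'a::real_normed_vector set"
  assumes "convex C" "closed C" "C \<noteq> {}" "x \<notin> C"
  obtains f :: "'a dual" and r where "0 < r" "\<And>c. c \<in> C \<Longrightarrow> blinfun_apply f x + r \<le> blinfun_apply f c"
proof -
  obtain r where "0 < r" and r: "\<And>c. c \<in> C \<Longrightarrow> r \<le> norm (c - x)"
  proof -
    obtain r where "0 < r" "ball x r \<subseteq> - C"
      using assms(2,4) open_contains_ball[of "- C"] by auto
    then show ?thesis using that[of r] by (force simp: dist_norm norm_minus_commute not_less)
  qed
  \<comment> \<open>A functional below \<open>p\<close> is at most \<open>- r\<close> at all \<open>x - c\<close>, as \<open>t = 1\<close> shows.\<close>
  define g where "g = (\<lambda>v (t, c). norm (v + t *\<^sub>R (c - x)) - t * r)"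
  define p where "p = (\<lambda>v. INF z\<in>{0..} \<times> C. g v z)"
  have lower: "- norm v \<le> g v (t, c)" if "0 \<le> t" "c \<in> C" for v t c
  proof -
    have "t * r \<le> norm (t *\<^sub>R (c - x))" using that r by (simp add: mult_left_mono)
    also have "\<dots> \<le> norm (v + t *\<^sub>R (c - x)) + norm v"
      using norm_triangle_ineq4[of "v + t *\<^sub>R (c - x)" v] by simp
    finally show ?thesis by (simp add: g_def)
  qed
  have le: "p v \<le> g v (t, c)" if "0 \<le> t" "c \<in> C" for v t c
    unfolding p_def using that lower by (intro cINF_lower bdd_belowI[of _ "- norm v"]) auto
  have ge: "b \<le> p v" if "\<And>t c. 0 \<le> t \<Longrightarrow> c \<in> C \<Longrightarrow> b \<le> g v (t, c)" for v b
    unfolding p_def using that \<open>C \<noteq> {}\<close> by (intro cINF_greatest) auto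
  have le_norm: "p v \<le> norm v" for v
    using le[of 0 _ v] \<open>C \<noteq> {}\<close> by (auto simp: g_def)
  have "sublinear p"
    unfolding sublinear_def
  proof (intro conjI allI impI)
    fix v w
    have *: "p (v + w) - g v (t, c) \<le> g w (s, d)"
      if tc: "0 \<le> t" "c \<in> C" "0 \<le> s" "d \<in> C" for t c s d
    proof -
      \<comment> \<open>Convexity merges two directions into one: \<open>e\<close> is the mean of
        \<open>c\<close> and \<open>d\<close> with weights proportional to \<open>t\<close> and
        \<open>s\<close>.\<close>
      obtain e where e: "e \<in> C" "(t + s) *\<^sub>R (e - x) = t *\<^sub>R (c - x) + s *\<^sub>R (d - x)"
      proof (cases "t + s = 0")
        case True
        then have "t = 0" "s = 0" using tc by auto
        then show ?thesis using that[of c] tc by simp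
      next
        case False
        define e where "e = (t / (t + s)) *\<^sub>R c + (s / (t + s)) *\<^sub>R d"
        have "e \<in> C" unfolding e_def using \<open>convex C\<close> tc False
          by (intro convexD) (auto simp: add_divide_distrib[symmetric])
        moreover have "(t + s) *\<^sub>R e = t *\<^sub>R c + s *\<^sub>R d"
          using False by (simp add: e_def scaleR_right_distrib)
        ultimately show ?thesis using that[of e] by (simp add: algebra_simps)
      qed
      have "p (v + w) \<le> g (v + w) (t + s, e)" using tc e by (intro le) auto
      also have "\<dots> \<le> g v (t, c) + g w (s, d)"
        using norm_triangle_ineq[of "v + t *\<^sub>R (c - x)" "w + s *\<^sub>R (d - x)"]
        unfolding g_def prod.case e(2) by (simp add: distrib_right add_ac)
      finally show ?thesis by simp
    qed
    have "p (v + w) - p w \<le> g v (t, c)" if "0 \<le> t" "c \<in> C" for t c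
      using ge[of "p (v + w) - g v (t, c)" w] * that by fastforce
    then show "p (v + w) \<le> p v + p w" using ge[of "p (v + w) - p w" v] by fastforce
  next
    fix s :: real and v assume "0 \<le> s"
    show "p (s *\<^sub>R v) \<le> s * p v"
    proof (cases "s = 0")
      case True
      then show ?thesis using le_norm[of 0] by simp
    next
      case False
      then have "0 < s" using \<open>0 \<le> s\<close> by simp
      have "p (s *\<^sub>R v) / s \<le> g v (t, c)" if "0 \<le> t" "c \<in> C" for t c
      proof -
        have "p (s *\<^sub>R v) \<le> g (s *\<^sub>R v) (s * t, c)" using \<open>0 < s\<close> that by (intro le) auto
        also have "s *\<^sub>R v + (s * t) *\<^sub>R (c - x) = s *\<^sub>R (v + t *\<^sub>R (c - x))"
          by (simp add: algebra_simps)
        then have "g (s *\<^sub>R v) (s * t, c) = s * g v (t, c)"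
          using \<open>0 < s\<close> by (simp add: g_def right_diff_distrib)
        finally show ?thesis using \<open>0 < s\<close> by (simp add: field_simps)
      qed
      then show ?thesis using ge[of "p (s *\<^sub>R v) / s" v] \<open>0 < s\<close> by (simp add: field_simps)
    qed
  qed
  then obtain f where f: "linear f" "\<And>v. f v \<le> p v" using Hahn_Banach_sublinear by blast
  have "\<bar>f v\<bar> \<le> norm v" for v
    using f(2)[of v] f(2)[of "- v"] le_norm[of v] le_norm[of "- v"] linear_neg[OF f(1), of v]
    by simp
  then have bl: "bounded_linear f"
    using f(1) by (auto simp: bounded_linear_def bounded_linear_axioms_def intro!: exI[of _ 1])
  have "f x + r \<le> f c" if "c \<in> C" for c
  proof -
    have "f (x - c) \<le> - r"
      using f(2)[of "x - c"] le[of 1 c "x - c"] that by (simp add: g_def)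
    then show ?thesis by (simp add: linear_diff[OF f(1)])
  qed
  then show ?thesis using that[of r "Blinfun f"] \<open>0 < r\<close> by (simp add: bounded_linear_Blinfun_apply[OF bl])
qed

section \<open>Weakly closed convex sets and separation of points\<close>

lemma continuous_map_weak_topology_functional:
  "continuous_map weak_topology euclideanreal (blinfun_apply (f :: 'a::real_normed_vector dual))"
  using continuous_map_weak_topology_iff[of "weak_topology :: 'a topology" "\<lambda>x. x"] by simp

text \<open>Mazur's theorem: each point outside \<open>C\<close> lies in a weakly open half space,
  cut out by a separating functional, that misses \<open>C\<close>.\<close>

lemma closedin_weak_topology_convex:
  fixes C :: "'a::real_normed_vector set"
  assumes "convex C" "closed C"
  shows "closedin weak_topology C"
proof (cases "C = {}")
  case False
  have "openin weak_topology (- C)"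
  proof (subst openin_subopen, safe)
    fix x assume "x \<notin> C"
    then obtain f :: "'a dual" and r where f: "0 < r" "\<And>c. c \<in> C \<Longrightarrow> f x + r \<le> f c"
      using separating_functional_closed_convex[OF assms False] by metis
    have "openin weak_topology {y \<in> topspace weak_topology. f y \<in> {..<f x + r}}"
      by (rule openin_continuous_map_preimage[OF continuous_map_weak_topology_functional]) simp
    then show "\<exists>U. openin weak_topology U \<and> x \<in> U \<and> U \<subseteq> - C"
      using f by (intro exI[of _ "{y. f y < f x + r}"]) force
  qed
  then show ?thesis by (simp add: closedin_def Compl_eq_Diff_UNIV)
qed simp

lemma Hausdorff_space_weak_topology: "Hausdorff_space (weak_topology :: 'a::real_normed_vector topology)"
  unfolding Hausdorff_space_def
proof (intro allI impI)
  fix x y :: 'a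
  assume xy: "x \<in> topspace weak_topology \<and> y \<in> topspace weak_topology \<and> x \<noteq> y"
  obtain f :: "'a dual" and r where f: "0 < r" "f x + r \<le> f y"
    using separating_functional_closed_convex[of "{y}" x] xy
    by (metis closed_singleton convex_singleton insert_not_empty singletonD singletonI)
  have "openin weak_topology {z \<in> topspace weak_topology. f z \<in> {..<f x + r/2}}"
       "openin weak_topology {z \<in> topspace weak_topology. f z \<in> {f x + r/2<..}}"
    by (rule openin_continuous_map_preimage[OF continuous_map_weak_topology_functional]; simp)+
  then show "\<exists>U V. openin weak_topology U \<and> openin weak_topology V \<and> x \<in> U \<and> y \<in> V \<and> disjnt U V"
    using f by (intro exI[of _ "{z. f z < f x + r/2}"] exI[of _ "{z. f z > f x + r/2}"])
      (auto simp: disjnt_def)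
qed

section \<open>Norm compact invariant sets of left reversible nonexpansive actions\<close>

lemma compact_space_directed_Inter_nonempty:
  assumes "compact_space X" "\<C> \<noteq> {}"
    and closed: "\<And>C. C \<in> \<C> \<Longrightarrow> closedin X C" and nonempty: "\<And>C. C \<in> \<C> \<Longrightarrow> C \<noteq> {}"
    and directed: "\<And>C D. C \<in> \<C> \<Longrightarrow> D \<in> \<C> \<Longrightarrow> \<exists>E\<in>\<C>. E \<subseteq> C \<inter> D"
  shows "\<Inter>\<C> \<noteq> {}"
proof -
  \<comment> \<open>Each finite intersection contains a member of the family, which gives the finite
    intersection property.\<close>
  have "\<exists>E\<in>\<C>. E \<subseteq> \<Inter>\<F>" if "finite \<F>" "\<F> \<subseteq> \<C>" for \<F>
    using that
  proof (induction \<F>)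
    case empty
    then show ?case using assms(2) by auto
  next
    case (insert C \<F>)
    then obtain E where "E \<in> \<C>" "E \<subseteq> \<Inter>\<F>" by auto
    then obtain E' where "E' \<in> \<C>" "E' \<subseteq> C \<inter> E" using directed[of C E] insert.prems by auto
    then show ?case using \<open>E \<subseteq> \<Inter>\<F>\<close> by auto
  qed
  then have "\<Inter>\<F> \<noteq> {}" if "finite \<F>" "\<F> \<subseteq> \<C>" for \<F>
    using that nonempty by (metis subset_empty)
  with closed show ?thesis
    using compact_space_fip[THEN iffD1, OF assms(1), rule_format, of \<C>] by simp
qed

lemma chain_directed:
  assumes "subset.chain \<A> \<C>" "C \<in> \<C>" "D \<in> \<C>"
  shows "\<exists>E\<in>\<C>. E \<subseteq> C \<inter> D"
proof -
  have "C \<subseteq> D \<or> D \<subseteq> C" using assms by (simp add: subset_chain_def)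
  then show ?thesis using assms(2,3) by (metis Int_absorb1 Int_absorb2 order_refl)
qed

text \<open>Complements turn intersections of chains into unions, for which Zorn's lemma yields
  maximal sets.\<close>

lemma Zorn_minimal_set:
  assumes "\<A> \<noteq> {}" and chain: "\<And>\<C>. \<C> \<noteq> {} \<Longrightarrow> subset.chain \<A> \<C> \<Longrightarrow> \<Inter>\<C> \<in> \<A>"
  shows "\<exists>M\<in>\<A>. \<forall>N\<in>\<A>. N \<subseteq> M \<longrightarrow> N = M"
proof -
  have "\<exists>M\<in>uminus ` \<A>. \<forall>N\<in>uminus ` \<A>. M \<subseteq> N \<longrightarrow> N = M"
  proof (rule subset_Zorn_nonempty)
    fix \<C> assume "\<C> \<noteq> {}" "subset.chain (uminus ` \<A>) \<C>"
    then have "subset.chain \<A> (uminus ` \<C>)"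
      unfolding subset_chain_def by (auto simp: image_subset_iff)
    then have "\<Inter>(uminus ` \<C>) \<in> \<A>" using \<open>\<C> \<noteq> {}\<close> by (intro chain) auto
    moreover have "\<Union>\<C> = - \<Inter>(uminus ` \<C>)" by auto
    ultimately show "\<Union>\<C> \<in> uminus ` \<A>" by blast
  qed (use assms in auto)
  then show ?thesis by auto
qed

text \<open>Two structures share one set: \<open>X\<close> will be the weak topology on a minimal
  weakly compact convex set, and the metric comes from the norm. The link between them is
  \<open>closedin_cball\<close>, a lower semicontinuity of the distance; \<open>separable_X\<close>
  refers to the metric.\<close>

locale nonexpansive_flow =
  fixes X :: "'a::complete_space topology" and S :: "'s::semigroup_mult set"
    and T :: "'s \<Rightarrow> 'a \<Rightarrow> 'a"
  assumes compact_X: "compact_space X" and Hausdorff_X: "Hausdorff_space X"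
    and X_nonempty: "topspace X \<noteq> {}" and closed_X: "closed (topspace X)"
    and closedin_cball: "closedin X (topspace X \<inter> cball q e)"
    and separable_X: "\<exists>Q. countable Q \<and> topspace X \<subseteq> closure Q"
    and S_nonempty: "S \<noteq> {}"
    and mult_closed: "s \<in> S \<Longrightarrow> t \<in> S \<Longrightarrow> s * t \<in> S"
    and reversible: "s \<in> S \<Longrightarrow> t \<in> S \<Longrightarrow> \<exists>u\<in>S. \<exists>v\<in>S. s * u = t * v"
    and T_mult: "s \<in> S \<Longrightarrow> t \<in> S \<Longrightarrow> x \<in> topspace X \<Longrightarrow> T (s * t) x = T s (T t x)"
    and T_continuous: "s \<in> S \<Longrightarrow> continuous_map X X (T s)"
    and T_nonexpansive: "s \<in> S \<Longrightarrow> x \<in> topspace X \<Longrightarrow> y \<in> topspace X \<Longrightarrow>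
          dist (T s x) (T s y) \<le> dist x y"
begin

lemma T_mem: "s \<in> S \<Longrightarrow> x \<in> topspace X \<Longrightarrow> T s x \<in> topspace X"
  using T_continuous continuous_map_image_subset_topspace by fastforce

lemma closedin_image: "s \<in> S \<Longrightarrow> closedin X A \<Longrightarrow> closedin X (T s ` A)"
  using T_continuous Hausdorff_X compact_X
  by (meson closedin_compact_space compactin_imp_closedin image_compactin)

lemma closedin_fibre:
  assumes "s \<in> S" "closedin X A" "y \<in> topspace X"
  shows "closedin X {x \<in> A. T s x = y}"
proof -
  have "closedin X {x \<in> topspace X. T s x \<in> {y}}"
    using T_continuous[OF assms(1)] Hausdorff_X assms(3)
    by (intro closedin_continuous_map_preimage) (auto intro: closedin_Hausdorff_singleton)
  then have "closedin X (A \<inter> {x \<in> topspace X. T s x \<in> {y}})"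
    using assms(2) by blast
  moreover have "A \<inter> {x \<in> topspace X. T s x \<in> {y}} = {x \<in> A. T s x = y}"
    using closedin_subset[OF assms(2)] by auto
  ultimately show ?thesis by simp
qed

lemma image_mult:
  assumes "s \<in> S" "t \<in> S" "A \<subseteq> topspace X"
  shows "T (s * t) ` A = T s ` T t ` A"
  unfolding image_image using assms T_mult by (intro image_cong) auto

section \<open>Minimal expanded sets\<close>

definition expanded :: "'a set \<Rightarrow> bool" where
  "expanded Z \<longleftrightarrow> closedin X Z \<and> (\<forall>s\<in>S. Z \<subseteq> T s ` Z)"

text \<open>The fibres of \<open>T s\<close> over a point of the intersection, taken within the
  members, are closed, nonempty and directed, so compactness gives a common preimage. The form of
  the last hypothesis fits both the family of images of \<open>topspace X\<close> and chains of
  expanded sets.\<close>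

lemma expanded_directed_Inter:
  assumes ne: "\<C> \<noteq> {}" and closed: "\<And>C. C \<in> \<C> \<Longrightarrow> closedin X C"
    and directed: "\<And>C D. C \<in> \<C> \<Longrightarrow> D \<in> \<C> \<Longrightarrow> \<exists>E\<in>\<C>. E \<subseteq> C \<inter> D"
    and sub: "\<And>C s. C \<in> \<C> \<Longrightarrow> s \<in> S \<Longrightarrow> \<Inter>\<C> \<subseteq> T s ` C"
  shows "expanded (\<Inter>\<C>)"
  unfolding expanded_def
proof (intro conjI ballI subsetI)
  show "closedin X (\<Inter>\<C>)" using ne closed by (rule closedin_Inter)
  fix s y assume s: "s \<in> S" and y: "y \<in> \<Inter>\<C>"
  have yX: "y \<in> topspace X" using y ne closed closedin_subset by blast
  have "\<Inter>((\<lambda>C. {x \<in> C. T s x = y}) ` \<C>) \<noteq> {}"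
  proof (rule compact_space_directed_Inter_nonempty[OF compact_X])
    fix C' D' assume "C' \<in> (\<lambda>C. {x \<in> C. T s x = y}) ` \<C>" "D' \<in> (\<lambda>C. {x \<in> C. T s x = y}) ` \<C>"
    then obtain C D where CD: "C \<in> \<C>" "D \<in> \<C>" "C' = {x \<in> C. T s x = y}" "D' = {x \<in> D. T s x = y}"
      by auto
    obtain E where "E \<in> \<C>" "E \<subseteq> C \<inter> D" using directed[OF CD(1,2)] ..
    then show "\<exists>E\<in>(\<lambda>C. {x \<in> C. T s x = y}) ` \<C>. E \<subseteq> C' \<inter> D'"
      unfolding CD(3,4) by (intro bexI[of _ "{x \<in> E. T s x = y}"] imageI) auto
  next
    fix C' assume "C' \<in> (\<lambda>C. {x \<in> C. T s x = y}) ` \<C>"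
    then obtain C where C: "C \<in> \<C>" "C' = {x \<in> C. T s x = y}" by auto
    show "closedin X C'" unfolding C(2) by (rule closedin_fibre[OF s closed[OF C(1)] yX])
    have "y \<in> T s ` C" using sub[OF C(1) s] y by (rule subsetD)
    then show "C' \<noteq> {}" unfolding C(2) by auto
  qed (use ne in simp)
  then show "y \<in> T s ` \<Inter>\<C>" using ne by auto
qed

text \<open>If \<open>s * u = t * v\<close>, the image under this product lies in the images under
  \<open>s\<close> and \<open>t\<close>, so the images of \<open>topspace X\<close> are directed.
  Moreover \<open>T s\<close> maps the image under \<open>t\<close> onto the image under
  \<open>s * t\<close>, a member of the same family.\<close>

lemma exists_expanded: "\<exists>Z. expanded Z \<and> Z \<noteq> {}"
proof -
  define \<C> where "\<C> = (\<lambda>s. T s ` topspace X) ` S"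
  have closed: "closedin X C" "C \<noteq> {}" if "C \<in> \<C>" for C
    using that X_nonempty by (auto simp: \<C>_def intro: closedin_image)
  have ne: "\<C> \<noteq> {}" using S_nonempty by (simp add: \<C>_def)
  have directed: "\<exists>E\<in>\<C>. E \<subseteq> C \<inter> D" if CD: "C \<in> \<C>" "D \<in> \<C>" for C D
  proof -
    obtain s t where st: "s \<in> S" "t \<in> S" "C = T s ` topspace X" "D = T t ` topspace X"
      using CD by (auto simp: \<C>_def)
    obtain u v where uv: "u \<in> S" "v \<in> S" "s * u = t * v" using reversible st by blast
    have "T (s * u) ` topspace X \<subseteq> C" "T (t * v) ` topspace X \<subseteq> D"
      using st(1,2) uv(1,2) T_mem unfolding st(3,4) by (auto simp: T_mult)
    moreover have "T (s * u) ` topspace X \<in> \<C>" using uv st mult_closed by (simp add: \<C>_def)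
    ultimately show ?thesis using uv(3) by auto
  qed
  have "expanded (\<Inter>\<C>)"
  proof (rule expanded_directed_Inter[OF ne closed(1) directed])
    fix C s assume "C \<in> \<C>" "s \<in> S"
    then obtain t where "t \<in> S" "C = T t ` topspace X" by (auto simp: \<C>_def)
    then have "T s ` C \<in> \<C>"
      using \<open>s \<in> S\<close> mult_closed[of s t] image_mult[of s t "topspace X"]
      unfolding \<C>_def by (metis (no_types, lifting) image_eqI order_refl)
    then show "\<Inter>\<C> \<subseteq> T s ` C" by auto
  qed
  moreover have "\<Inter>\<C> \<noteq> {}"
    by (rule compact_space_directed_Inter_nonempty[OF compact_X ne closed directed])
  ultimately show ?thesis by blast
qed

lemma exists_minimal_expanded:
  "\<exists>Z. expanded Z \<and> Z \<noteq> {} \<and> (\<forall>Z'. expanded Z' \<longrightarrow> Z' \<subseteq> Z \<longrightarrow> Z' \<noteq> {} \<longrightarrow> Z' = Z)"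
proof -
  define \<A> where "\<A> = {Z. expanded Z \<and> Z \<noteq> {}}"
  have "\<exists>Z\<in>\<A>. \<forall>N\<in>\<A>. N \<subseteq> Z \<longrightarrow> N = Z"
  proof (rule Zorn_minimal_set)
    show "\<A> \<noteq> {}" using exists_expanded by (simp add: \<A>_def)
    fix \<C> assume ne: "\<C> \<noteq> {}" and chain: "subset.chain \<A> \<C>"
    then have sub: "\<C> \<subseteq> \<A>" by (simp add: subset_chain_def)
    have \<C>: "closedin X C" "C \<noteq> {}" if "C \<in> \<C>" for C
      using that sub by (auto simp: \<A>_def expanded_def)
    have "\<Inter>\<C> \<noteq> {}"
      by (rule compact_space_directed_Inter_nonempty[OF compact_X ne \<C> chain_directed[OF chain]])
    moreover have "expanded (\<Inter>\<C>)"
    proof (rule expanded_directed_Inter[OF ne \<C>(1) chain_directed[OF chain]])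
      fix C s assume "C \<in> \<C>" "s \<in> S"
      then have "C \<subseteq> T s ` C" using sub by (simp add: \<A>_def expanded_def subset_iff)
      then show "\<Inter>\<C> \<subseteq> T s ` C" using \<open>C \<in> \<C>\<close> by (meson Inter_lower order_trans)
    qed
    ultimately show "\<Inter>\<C> \<in> \<A>" by (simp add: \<A>_def)
  qed
  then obtain Z where Z: "Z \<in> \<A>" "\<forall>N\<in>\<A>. N \<subseteq> Z \<longrightarrow> N = Z" ..
  show ?thesis
  proof (intro exI[of _ Z] conjI allI impI)
    show "expanded Z" "Z \<noteq> {}" using Z(1) by (simp_all add: \<A>_def)
    fix Z' assume "expanded Z'" "Z' \<subseteq> Z" "Z' \<noteq> {}"
    then have "Z' \<in> \<A>" by (simp add: \<A>_def)
    from bspec[OF Z(2) this] \<open>Z' \<subseteq> Z\<close> show "Z' = Z" by (rule mp)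
  qed
qed

section \<open>Finite ball covers and removal of small open pieces\<close>

definition finitely_covered :: "real \<Rightarrow> 'a set \<Rightarrow> bool" where
  "finitely_covered e A \<longleftrightarrow> (\<exists>Q. finite Q \<and> Q \<subseteq> topspace X \<and> A \<subseteq> (\<Union>q\<in>Q. cball q e))"

lemma finitely_covered_mono: "finitely_covered e B \<Longrightarrow> A \<subseteq> B \<Longrightarrow> finitely_covered e A"
  unfolding finitely_covered_def by blast

lemma finitely_covered_Union:
  assumes "finite \<F>" "\<And>A. A \<in> \<F> \<Longrightarrow> finitely_covered e A"
  shows "finitely_covered e (\<Union>\<F>)"
proof -
  obtain Q where Q: "\<And>A. A \<in> \<F> \<Longrightarrow> finite (Q A) \<and> Q A \<subseteq> topspace X \<and> A \<subseteq> (\<Union>q\<in>Q A. cball q e)"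
    using assms(2) unfolding finitely_covered_def by metis
  show ?thesis
    unfolding finitely_covered_def
  proof (intro exI[of _ "\<Union>(Q ` \<F>)"] conjI)
    show "finite (\<Union>(Q ` \<F>))" "\<Union>(Q ` \<F>) \<subseteq> topspace X" using Q assms(1) by auto
    show "\<Union>\<F> \<subseteq> (\<Union>q\<in>\<Union>(Q ` \<F>). cball q e)" using Q by blast
  qed
qed

text \<open>The images of the centres are the new centres, with the same radius. This is why centres
  have to lie in \<open>topspace X\<close>, where \<open>T s\<close> is nonexpansive.\<close>

lemma finitely_covered_image:
  assumes "s \<in> S" "A \<subseteq> topspace X" "finitely_covered e A"
  shows "finitely_covered e (T s ` A)"
proof -
  obtain Q where Q: "finite Q" "Q \<subseteq> topspace X" "A \<subseteq> (\<Union>q\<in>Q. cball q e)"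
    using assms(3) unfolding finitely_covered_def by auto
  have "T s ` A \<subseteq> (\<Union>q\<in>T s ` Q. cball q e)"
  proof clarify
    fix x assume "x \<in> A"
    then obtain q where "q \<in> Q" "dist q x \<le> e" using Q(3) by auto
    then have "dist (T s q) (T s x) \<le> e"
      using T_nonexpansive[of s q x] assms(1,2) Q(2) \<open>x \<in> A\<close> by fastforce
    then show "T s x \<in> (\<Union>q\<in>T s ` Q. cball q e)" using \<open>q \<in> Q\<close> by auto
  qed
  then show ?thesis
    unfolding finitely_covered_def using Q assms(1) T_mem by (intro exI[of _ "T s ` Q"]) auto
qed

text \<open>Removing this set is a derivation in the style of Cantor--Bendixson and Szlenk: there
  remain the points of \<open>Z\<close> none of whose open neighbourhoods has a trace on
  \<open>Z\<close> covered by finitely many \<open>e\<close>-balls.\<close>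

definition fragment :: "real \<Rightarrow> 'a set \<Rightarrow> 'a set" where
  "fragment e Z = \<Union>{U. openin X U \<and> finitely_covered e (U \<inter> Z)}"

lemma openin_fragment: "openin X (fragment e Z)"
  unfolding fragment_def by auto

text \<open>Finitely many small open sets cover the compact set \<open>A\<close>, and their union is
  still small.\<close>

lemma compact_subset_fragment:
  assumes "closedin X A" "A \<subseteq> fragment e Z"
  shows "\<exists>U. openin X U \<and> A \<subseteq> U \<and> finitely_covered e (U \<inter> Z)"
proof -
  have "compactin X A" using assms(1) compact_X by (rule closedin_compact_space[rotated])
  then obtain \<F> where \<F>: "finite \<F>" "\<F> \<subseteq> {U. openin X U \<and> finitely_covered e (U \<inter> Z)}" "A \<subseteq> \<Union>\<F>"
    using assms(2) unfolding compactin_def fragment_def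
    by (elim conjE allE[of _ "{U. openin X U \<and> finitely_covered e (U \<inter> Z)}"]) auto
  have "finitely_covered e (\<Union>((\<lambda>U. U \<inter> Z) ` \<F>))"
    using \<F> by (intro finitely_covered_Union) auto
  moreover have "\<Union>((\<lambda>U. U \<inter> Z) ` \<F>) = \<Union>\<F> \<inter> Z" by auto
  ultimately show ?thesis using \<F> by (intro exI[of _ "\<Union>\<F>"]) auto
qed

text \<open>If every preimage of \<open>x\<close> in \<open>Z\<close> were removed, the fibre would
  have a neighbourhood \<open>U\<close> with small trace on \<open>Z\<close>. The image of that
  trace contains a relative neighbourhood of \<open>x\<close>, so \<open>x\<close> would be removed
  as well.\<close>

lemma expanded_diff_fragment:
  assumes Z: "expanded Z"
  shows "expanded (Z - fragment e Z)"
  unfolding expanded_def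
proof (intro conjI ballI subsetI)
  have closed: "closedin X Z" and ZX: "Z \<subseteq> topspace X"
    using Z closedin_subset by (auto simp: expanded_def)
  show "closedin X (Z - fragment e Z)"
    using closed openin_fragment by (rule closedin_diff)
  fix s x assume s: "s \<in> S" and x: "x \<in> Z - fragment e Z"
  show "x \<in> T s ` (Z - fragment e Z)"
  proof (rule ccontr)
    assume "x \<notin> T s ` (Z - fragment e Z)"
    then have "{z \<in> Z. T s z = x} \<subseteq> fragment e Z" by auto
    moreover have "closedin X {z \<in> Z. T s z = x}"
      using s closed x ZX by (intro closedin_fibre) auto
    ultimately have "\<exists>U. openin X U \<and> {z \<in> Z. T s z = x} \<subseteq> U \<and> finitely_covered e (U \<inter> Z)"
      by (intro compact_subset_fragment)
    then obtain U where U: "openin X U" "{z \<in> Z. T s z = x} \<subseteq> U" "finitely_covered e (U \<inter> Z)"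
      by (elim exE conjE)
    \<comment> \<open>The image of \<open>Z - U\<close> is closed and misses \<open>x\<close>. A
      point of \<open>Z\<close> in \<open>V\<close> has a preimage in \<open>Z\<close>, which must
      then lie in \<open>U\<close>.\<close>
    define V where "V = topspace X - T s ` (Z - U)"
    have "openin X V"
      unfolding V_def using s closed U(1) by (intro openin_diff closedin_image closedin_diff) auto
    moreover have "Z \<subseteq> T s ` Z" using Z s by (simp add: expanded_def)
    then have "V \<inter> Z \<subseteq> T s ` (U \<inter> Z)" by (auto simp: V_def)
    then have "finitely_covered e (V \<inter> Z)"
      using s ZX U(3) finitely_covered_image finitely_covered_mono
      by (metis inf.coboundedI2)
    moreover have "x \<in> V" using x ZX U(2) by (auto simp: V_def)
    ultimately show False using x by (auto simp: fragment_def)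
  qed
qed

text \<open>Countably many closed balls cover the compact Hausdorff space \<open>Z\<close>, so by
  Baire's theorem one of them has interior points relative to \<open>Z\<close>.\<close>

lemma fragment_nonempty:
  assumes closed: "closedin X Z" and ne: "Z \<noteq> {}" and e: "0 < e"
  shows "Z \<inter> fragment e Z \<noteq> {}"
proof -
  define Y where "Y = subtopology X Z"
  have ZX: "Z \<subseteq> topspace X" using closed by (rule closedin_subset)
  then have Y: "topspace Y = Z" by (auto simp: Y_def)
  have "compact_space Y" "Hausdorff_space Y"
    unfolding Y_def using closedin_compact_space[OF compact_X closed] Hausdorff_X
    by (auto intro: compact_space_subtopology Hausdorff_space_subtopology)
  then have Baire: "locally_compact_space Y \<and> regular_space Y"
    by (simp add: compact_Hausdorff_imp_regular_space compact_imp_locally_compact_space)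
  obtain Q where Q: "countable Q" "topspace X \<subseteq> closure Q" using separable_X by auto
  \<comment> \<open>The radius is \<open>e/2\<close> because points of \<open>Q\<close> may lie
    outside \<open>topspace X\<close>: moving the centre to a point \<open>x\<close> of
    \<open>Z\<close> doubles the radius.\<close>
  define \<G> where "\<G> = (\<lambda>q. Z \<inter> cball q (e/2)) ` Q"
  have "Z \<subseteq> \<Union>\<G>"
  proof
    fix x assume "x \<in> Z"
    then have "x \<in> closure Q" using Q ZX by auto
    then obtain q where "q \<in> Q" "dist q x < e/2" using e unfolding closure_approachable by (metis half_gt_zero)
    then have "x \<in> Z \<inter> cball q (e/2)" using \<open>x \<in> Z\<close> by simp
    then show "x \<in> \<Union>\<G>" using \<open>q \<in> Q\<close> unfolding \<G>_def by blast
  qed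
  then have "\<Union>\<G> = topspace Y" using Y by (auto simp: \<G>_def)
  then have "Y interior_of \<Union>\<G> \<noteq> {}" using Y ne by (metis interior_of_topspace)
  moreover have "closedin Y G" if G: "G \<in> \<G>" for G
  proof -
    obtain q where "G = Z \<inter> cball q (e/2)" using G by (auto simp: \<G>_def)
    then have "G = (topspace X \<inter> cball q (e/2)) \<inter> Z" using ZX by auto
    then show ?thesis unfolding Y_def closedin_subtopology using closedin_cball by blast
  qed
  ultimately obtain G where G: "G \<in> \<G>" "Y interior_of G \<noteq> {}"
    using Baire_category_alt[OF disjI2[OF Baire], of \<G>] Q(1) by (auto simp: \<G>_def)
  then obtain q where q: "G = Z \<inter> cball q (e/2)" by (auto simp: \<G>_def)
  obtain x where x: "x \<in> Y interior_of G" using G(2) by auto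
  have "openin Y (Y interior_of G)" by simp
  then obtain U where U: "openin X U" "Y interior_of G = U \<inter> Z"
    unfolding Y_def openin_subtopology by auto
  have small: "U \<inter> Z \<subseteq> cball q (e/2)" using interior_of_subset[of Y G] U(2) q by auto
  have "x \<in> U \<inter> Z" using x U(2) by simp
  then have xq: "dist q x \<le> e/2" using small by (simp add: subset_iff)
  have "U \<inter> Z \<subseteq> cball x e"
  proof
    fix y assume "y \<in> U \<inter> Z"
    then have "dist q y \<le> e/2" using small by (simp add: subset_iff)
    then show "y \<in> cball x e" using xq dist_triangle3[of x y q] by simp
  qed
  moreover have "x \<in> Z" using x U(2) by auto
  ultimately have "finitely_covered e (U \<inter> Z)"
    unfolding finitely_covered_def using ZX by (intro exI[of _ "{x}"]) auto
  then show ?thesis using x U by (auto simp: fragment_def)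
qed

text \<open>What remains after the removal is expanded and smaller than \<open>Z\<close>, hence
  empty. Compactness then puts \<open>Z\<close> into a single small open set.\<close>

lemma minimal_expanded_finitely_covered:
  assumes Z: "expanded Z" "Z \<noteq> {}"
    and minimal: "\<And>Z'. expanded Z' \<Longrightarrow> Z' \<subseteq> Z \<Longrightarrow> Z' \<noteq> {} \<Longrightarrow> Z' = Z"
    and e: "0 < e"
  shows "finitely_covered e Z"
proof -
  have closed: "closedin X Z" using Z(1) by (simp add: expanded_def)
  have "Z - fragment e Z \<noteq> Z" using fragment_nonempty[OF closed Z(2) e] by auto
  then have "Z - fragment e Z = {}" using minimal[OF expanded_diff_fragment[OF Z(1)] Diff_subset] by metis
  then have "Z \<subseteq> fragment e Z" by blast
  then obtain U where "Z \<subseteq> U" "finitely_covered e (U \<inter> Z)"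
    using compact_subset_fragment[OF closed] by blast
  then show ?thesis by (simp add: Int_absorb1)
qed

section \<open>Norm compact sets mapped onto themselves\<close>

theorem exists_compact_fixed_set:
  obtains Y where "compact Y" "Y \<noteq> {}" "Y \<subseteq> topspace X" "\<forall>s\<in>S. T s ` Y = Y"
proof -
  obtain Z where Z: "expanded Z" "Z \<noteq> {}"
    and "\<forall>Z'. expanded Z' \<longrightarrow> Z' \<subseteq> Z \<longrightarrow> Z' \<noteq> {} \<longrightarrow> Z' = Z"
    using exists_minimal_expanded by (elim exE conjE)
  then have minimal: "Z' = Z" if "expanded Z'" "Z' \<subseteq> Z" "Z' \<noteq> {}" for Z'
    using that by (elim allE[of _ Z'] impE)
  have ZX: "Z \<subseteq> topspace X" using Z(1) closedin_subset by (auto simp: expanded_def)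
  \<comment> \<open>Since \<open>T u\<close> expands \<open>Z\<close>, images of \<open>Z\<close>
    grow along right multiples. With reversibility this makes the union \<open>Y0\<close>
    directed.\<close>
  have grow: "T s ` Z \<subseteq> T (s * u) ` Z" if "s \<in> S" "u \<in> S" for s u
    using Z(1) that ZX unfolding image_mult[OF that ZX] by (intro image_mono) (simp add: expanded_def)
  define Y0 where "Y0 = (\<Union>s\<in>S. T s ` Z)"
  have Y0X: "Y0 \<subseteq> topspace X" using ZX T_mem by (auto simp: Y0_def)
  have finite_subset: "\<exists>s\<in>S. A \<subseteq> T s ` Z" if "finite A" "A \<subseteq> Y0" for A
    using that
  proof (induction A)
    case empty
    then show ?case using S_nonempty by auto
  next
    case (insert a A)
    then obtain s t where st: "s \<in> S" "A \<subseteq> T s ` Z" "t \<in> S" "a \<in> T t ` Z"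
      by (auto simp: Y0_def)
    obtain u v where uv: "u \<in> S" "v \<in> S" "s * u = t * v" using reversible st by blast
    have "insert a A \<subseteq> T (s * u) ` Z"
      using grow[of s u] grow[of t v] st uv by auto
    then show ?case using mult_closed st uv by blast
  qed
  have bounded: "\<exists>k. finite k \<and> Y0 \<subseteq> (\<Union>x\<in>k. cball x e)" if e: "0 < e" for e
  proof -
    obtain Q where Q: "finite Q" "Q \<subseteq> topspace X" "Z \<subseteq> (\<Union>q\<in>Q. cball q (e/2))"
      using minimal_expanded_finitely_covered[OF Z minimal, of "e/2"] e
      unfolding finitely_covered_def by auto
    \<comment> \<open>The covers of the images vary with \<open>s\<close>, but they all have at most
      \<open>card Q\<close> balls of radius \<open>e/2\<close>, and such a ball holds at most one
      point of an \<open>e\<close>-separated set. So the size of separated sets is bounded uniformly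
      in \<open>s\<close>.\<close>
    define sep where "sep = (\<lambda>A. finite A \<and> A \<subseteq> Y0 \<and> (\<forall>a\<in>A. \<forall>b\<in>A. a \<noteq> b \<longrightarrow> e < dist a b))"
    have card: "card A \<le> card Q" if A: "sep A" for A
    proof -
      have "\<exists>s\<in>S. A \<subseteq> T s ` Z" using A by (intro finite_subset) (simp_all add: sep_def)
      then obtain s where s: "s \<in> S" "A \<subseteq> T s ` Z" ..
      have "\<forall>a\<in>A. \<exists>q\<in>Q. dist (T s q) a \<le> e/2"
      proof
        fix a assume "a \<in> A"
        then obtain z where z: "z \<in> Z" "a = T s z" using s by auto
        then obtain q where q: "q \<in> Q" "dist q z \<le> e/2" using Q(3) by auto
        have "dist (T s q) (T s z) \<le> dist q z"
          using s(1) subsetD[OF Q(2) q(1)] subsetD[OF ZX z(1)] by (rule T_nonexpansive)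
        then show "\<exists>q\<in>Q. dist (T s q) a \<le> e/2"
          using q z(2) by (intro bexI[of _ q]) auto
      qed
      then obtain h where h: "\<And>a. a \<in> A \<Longrightarrow> h a \<in> Q \<and> dist (T s (h a)) a \<le> e/2" by metis
      have "inj_on h A"
      proof (rule inj_onI, rule ccontr)
        fix a b assume ab: "a \<in> A" "b \<in> A" "h a = h b" "a \<noteq> b"
        have "dist a b \<le> dist (T s (h a)) a + dist (T s (h b)) b"
          using ab(3) dist_triangle3[of a b "T s (h a)"] by simp
        moreover have "e < dist a b" using A ab by (simp add: sep_def)
        ultimately show False using h[OF ab(1)] h[OF ab(2)] by linarith
      qed
      then show ?thesis using h Q(1) by (intro card_inj_on_le[of h]) auto
    qed
    have "sep {}" by (simp add: sep_def)
    \<comment> \<open>The maximum principle asks for a strict bound, hence \<open>Suc\<close>. A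
      separated set of greatest size cannot be enlarged, so it is an \<open>e\<close>-net of
      \<open>Y0\<close>.\<close>
    moreover have "\<forall>A. sep A \<longrightarrow> card A < Suc (card Q)" using card by (simp add: le_imp_less_Suc)
    ultimately have "\<exists>A. sep A \<and> (\<forall>B. sep B \<longrightarrow> card B \<le> card A)"
      by (rule Lattices_Big.ex_has_greatest_nat)
    then obtain A where A: "sep A" and max: "\<forall>B. sep B \<longrightarrow> card B \<le> card A" by (elim exE conjE)
    have "Y0 \<subseteq> (\<Union>x\<in>A. cball x e)"
    proof (rule ccontr)
      assume "\<not> ?thesis"
      then obtain y where y: "y \<in> Y0" "\<And>a. a \<in> A \<Longrightarrow> e < dist a y" by force
      have "y \<notin> A" using y(2)[of y] e by auto
      moreover have "sep (insert y A)" using A y by (auto simp: sep_def dist_commute)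
      ultimately show False using max[rule_format, of "insert y A"] A by (simp add: sep_def)
    qed
    then show ?thesis using A unfolding sep_def by (intro exI[of _ A]) simp
  qed
  define Y where "Y = closure Y0"
  have "compact Y"
    unfolding compact_eq_totally_bounded
  proof (intro conjI allI impI)
    show "complete Y" by (simp add: Y_def complete_eq_closed)
    fix e :: real assume "0 < e"
    \<comment> \<open>A cover by closed balls of radius \<open>e/2\<close> passes to the closure and
      fits into open balls of radius \<open>e\<close>.\<close>
    then obtain k where k: "finite k" "Y0 \<subseteq> (\<Union>x\<in>k. cball x (e/2))" using bounded[of "e/2"] by auto
    then have "Y \<subseteq> (\<Union>x\<in>k. cball x (e/2))" unfolding Y_def by (intro closure_minimal closed_UN) auto
    also have "\<dots> \<subseteq> (\<Union>x\<in>k. ball x e)" using \<open>0 < e\<close> by (intro UN_mono) auto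
    finally show "\<exists>k. finite k \<and> Y \<subseteq> (\<Union>x\<in>k. ball x e)" using k(1) by auto
  qed
  have YX: "Y \<subseteq> topspace X" unfolding Y_def using Y0X closed_X by (rule closure_minimal)
  have "T s ` Y = Y" if s: "s \<in> S" for s
  proof
    have cont: "continuous_on Y (T s)"
      unfolding continuous_on_iff
    proof (intro ballI allI impI)
      fix x e assume "x \<in> Y" "(0::real) < e"
      then show "\<exists>d>0. \<forall>y\<in>Y. dist y x < d \<longrightarrow> dist (T s y) (T s x) < e"
        using T_nonexpansive[OF s subsetD[OF YX] subsetD[OF YX]]
        by (intro exI[of _ e]) (auto intro: le_less_trans)
    qed
    have "T s ` Y0 \<subseteq> Y0"
    proof
      fix y assume "y \<in> T s ` Y0"
      then obtain t z where "t \<in> S" "z \<in> Z" "y = T s (T t z)" by (auto simp: Y0_def)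
      then show "y \<in> Y0" using s mult_closed[of s t] T_mult[of s t z] ZX
        unfolding Y0_def by (intro UN_I[of "s * t"]) (auto intro!: image_eqI[of _ _ z])
    qed
    then show "T s ` Y \<subseteq> Y"
      unfolding Y_def using cont closure_subset
      by (intro image_closure_subset) (auto simp: Y_def)
    have "Y0 \<subseteq> T s ` Y0"
    proof
      fix y assume "y \<in> Y0"
      then obtain t where t: "t \<in> S" "y \<in> T t ` Z" by (auto simp: Y0_def)
      \<comment> \<open>The image under \<open>t\<close> is contained in the one under
        \<open>t * u = s * v\<close>, which lies in the range of \<open>T s\<close> on
        \<open>Y0\<close>.\<close>
      obtain u v where uv: "u \<in> S" "v \<in> S" "t * u = s * v" using reversible t s by blast
      then have "y \<in> T s ` T v ` Z" using grow[of t u] t s ZX by (auto simp: image_mult)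
      then show "y \<in> T s ` Y0" using uv by (auto simp: Y0_def)
    qed
    also have "\<dots> \<subseteq> T s ` Y" unfolding Y_def using closure_subset by blast
    finally have "Y0 \<subseteq> T s ` Y" .
    moreover have "closed (T s ` Y)"
      using compact_continuous_image[OF cont \<open>compact Y\<close>] by (rule compact_imp_closed)
    ultimately show "Y \<subseteq> T s ` Y" unfolding Y_def by (intro closure_minimal)
  qed
  moreover have "Y \<noteq> {}" using Z(2) S_nonempty by (auto simp: Y_def Y0_def)
  ultimately show ?thesis using that[of Y] \<open>compact Y\<close> YX by blast
qed

end

section \<open>Chebyshev centres in L-embedded sets\<close>

definition weak_eval :: "'a::real_normed_vector \<Rightarrow> 'a dual \<Rightarrow> real" where
  "weak_eval x = (\<lambda>f. blinfun_apply f x)"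

text \<open>Additivity, homogeneity and the bound by \<open>M\<close> are closed conditions in the
  product space, so they pass to the limit \<open>g\<close>. As the weak* topology is a pullback of
  the product topology, membership in the closure carries over.\<close>

lemma weak_eval_closure_imp_bidual:
  fixes A :: "'a::real_normed_vector set"
  assumes A: "\<And>x. x \<in> A \<Longrightarrow> norm x \<le> M" and g: "g \<in> closure (weak_eval ` A)"
  shows "\<exists>u :: 'a bidual. blinfun_apply u = g \<and>
           u \<in> weak_star_topology closure_of (canonical_embedding ` A)"
proof -
  have mem: "g \<in> P" if "closed P" "\<And>x. x \<in> A \<Longrightarrow> weak_eval x \<in> P" for P
    using closure_minimal[OF _ that(1), of "weak_eval ` A"] that(2) g by blast
  have eval: "continuous_on UNIV (\<lambda>h :: 'a dual \<Rightarrow> real. h f)" for f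
    by (rule continuous_on_product_coordinates)
  have add: "g (f1 + f2) = g f1 + g f2" for f1 f2
  proof -
    have "closed {h :: 'a dual \<Rightarrow> real. h (f1 + f2) = h f1 + h f2}"
      by (intro closed_Collect_eq continuous_on_add eval)
    from mem[OF this] show ?thesis by (simp add: weak_eval_def blinfun.add_left)
  qed
  have scale: "g (c *\<^sub>R f) = c * g f" for c f
  proof -
    have "closed {h :: 'a dual \<Rightarrow> real. h (c *\<^sub>R f) = c * h f}"
      by (intro closed_Collect_eq continuous_on_mult_left eval)
    from mem[OF this] show ?thesis by (simp add: weak_eval_def blinfun.scaleR_left)
  qed
  have bound: "\<bar>g f\<bar> \<le> norm f * M" for f
  proof -
    have "closed {h :: 'a dual \<Rightarrow> real. \<bar>h f\<bar> \<le> norm f * M}"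
      by (intro closed_Collect_le continuous_on_rabs continuous_on_const eval)
    moreover have "\<bar>weak_eval x f\<bar> \<le> norm f * M" if "x \<in> A" for x
      using norm_blinfun[of f x] A[OF that] mult_left_mono[of "norm x" M "norm f"]
      by (simp add: weak_eval_def)
    ultimately show ?thesis using mem[of "{h. \<bar>h f\<bar> \<le> norm f * M}"] by simp
  qed
  have "bounded_linear g"
    by (rule bounded_linear_intro[of g M]) (use add scale bound in auto)
  then have u: "blinfun_apply (Blinfun g) = g" by (rule bounded_linear_Blinfun_apply)
  have "Blinfun g \<in> weak_star_topology closure_of (canonical_embedding ` A)"
    unfolding in_closure_of
  proof (intro conjI allI impI)
    show "Blinfun g \<in> topspace weak_star_topology" by (simp add: strong_operator_topology_topspace)
    fix V assume V: "Blinfun g \<in> V \<and> openin weak_star_topology V"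
    then obtain O' where O': "open O'" "V = blinfun_apply -` O'"
      unfolding strong_operator_topology_def openin_pullback_topology by auto
    then have "g \<in> O'" using V u by auto
    then have "O' \<inter> weak_eval ` A \<noteq> {}"
      using open_Int_closure_eq_empty[OF O'(1), of "weak_eval ` A"] g by auto
    then obtain x where x: "x \<in> A" "weak_eval x \<in> O'" by auto
    moreover have "blinfun_apply (canonical_embedding x) = weak_eval x"
      by (simp add: weak_eval_def fun_eq_iff)
    ultimately show "\<exists>y. y \<in> canonical_embedding ` A \<and> y \<in> V" using O'(2) by auto
  qed
  then show ?thesis using u by blast
qed

text \<open>Balls of the bidual are weak* closed: each functional \<open>f\<close> contributes a
  closed slab, and together the slabs bound the norm.\<close>

lemma norm_weak_star_closure_le:
  fixes u :: "'a::real_normed_vector bidual"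
  assumes u: "u \<in> weak_star_topology closure_of (canonical_embedding ` A)"
    and A: "\<And>x. x \<in> A \<Longrightarrow> norm (x - b) \<le> r" and "0 \<le> r"
  shows "norm (u - canonical_embedding b) \<le> r"
proof (rule norm_blinfun_bound[OF \<open>0 \<le> r\<close>])
  fix f :: "'a dual"
  define P where "P = {h :: 'a bidual. h f \<in> {blinfun_apply f b - r * norm f .. f b + r * norm f}}"
  have "closedin weak_star_topology
          {h \<in> topspace weak_star_topology. h f \<in> {blinfun_apply f b - r * norm f .. f b + r * norm f}}"
    by (rule closedin_continuous_map_preimage[OF strong_operator_topology_continuous_evaluation]) simp
  then have "closedin weak_star_topology P"
    by (simp add: P_def strong_operator_topology_topspace)
  moreover have "canonical_embedding ` A \<subseteq> P"
  proof clarify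
    fix x assume "x \<in> A"
    have "\<bar>f x - f b\<bar> \<le> norm f * norm (x - b)"
      using norm_blinfun[of f "x - b"] by (simp add: blinfun.diff_right)
    also have "\<dots> \<le> r * norm f" using A[OF \<open>x \<in> A\<close>] by (subst mult.commute) (rule mult_right_mono, simp_all)
    finally show "canonical_embedding x \<in> P" by (simp add: P_def abs_le_iff algebra_simps)
  qed
  ultimately have "u \<in> P" using u closure_of_minimal by blast
  then show "norm ((u - canonical_embedding b) f) \<le> r * norm f"
    by (simp add: P_def blinfun.diff_left abs_le_iff algebra_simps)
qed

text \<open>Weakly open sets are preimages under \<open>weak_eval\<close> of open sets of the
  product space, so covers can be transported there.\<close>

lemma compactin_weak_topology_if_compact_eval:
  assumes "compact (weak_eval ` W)"
  shows "compactin weak_topology W"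
  unfolding compactin_def
proof (intro conjI allI impI)
  fix \<U> assume \<U>: "(\<forall>U\<in>\<U>. openin weak_topology U) \<and> W \<subseteq> \<Union>\<U>"
  have "\<forall>U\<in>\<U>. \<exists>O'. open O' \<and> U = weak_eval -` O'"
    using \<U> unfolding weak_topology_def openin_pullback_topology weak_eval_def by auto
  then obtain O' where O': "\<And>U. U \<in> \<U> \<Longrightarrow> open (O' U) \<and> U = weak_eval -` O' U" by metis
  have "weak_eval ` W \<subseteq> \<Union>(O' ` \<U>)" using \<U> O' by blast
  then obtain \<D> where "\<D> \<subseteq> O' ` \<U>" "finite \<D>" "weak_eval ` W \<subseteq> \<Union>\<D>"
    using compactE[OF assms] O' by (metis (no_types, lifting) imageE)
  then obtain \<F> where \<F>: "\<F> \<subseteq> \<U>" "finite \<F>" "weak_eval ` W \<subseteq> \<Union>(O' ` \<F>)"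
    by (metis finite_subset_image)
  have "W \<subseteq> \<Union>\<F>"
  proof
    fix x assume "x \<in> W"
    then obtain U where "U \<in> \<F>" "weak_eval x \<in> O' U" using \<F>(3) by auto
    then show "x \<in> \<Union>\<F>" using O'[of U] \<F>(1) by auto
  qed
  then show "\<exists>\<F>. finite \<F> \<and> \<F> \<subseteq> \<U> \<and> W \<subseteq> \<Union>\<F>" using \<F> by auto
qed simp

text \<open>A product of compact intervals, compact by Tychonoff's theorem as in the proof of
  Banach--Alaoglu.\<close>

lemma compact_dual_box:
  "compact {g :: 'a::real_normed_vector dual \<Rightarrow> real. \<forall>f. \<bar>g f\<bar> \<le> norm f * M}"
proof -
  have "compactin (product_topology (\<lambda>_. euclideanreal) UNIV)
          (PiE UNIV (\<lambda>f :: 'a dual. {- (norm f * M) .. norm f * M}))"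
    by (subst compactin_PiE) auto
  moreover have "PiE UNIV (\<lambda>f :: 'a dual. {- (norm f * M) .. norm f * M})
      = {g. \<forall>f. \<bar>g f\<bar> \<le> norm f * M}"
    by (auto simp: PiE_def Pi_def abs_le_iff minus_le_iff)
  ultimately show ?thesis by (simp add: euclidean_product_topology)
qed

section \<open>Existence and weak compactness of Chebyshev centres\<close>

definition near_centres :: "'a::real_normed_vector set \<Rightarrow> 'a set \<Rightarrow> real \<Rightarrow> 'a set" where
  "near_centres C B r = {c \<in> C. \<forall>b\<in>B. norm (c - b) \<le> r}"

definition Chebyshev_radius :: "'a::real_normed_vector set \<Rightarrow> 'a set \<Rightarrow> real" where
  "Chebyshev_radius C B = Inf {r. near_centres C B r \<noteq> {}}"

text \<open>The radius \<open>r0\<close> makes the set of admissible radii nonempty, a point of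
  \<open>B\<close> bounds it below by 0, and enlarging a radius keeps it admissible.\<close>

lemma
  assumes "near_centres C B r0 \<noteq> {}" "B \<noteq> {}"
  shows Chebyshev_radius_le: "near_centres C B r \<noteq> {} \<Longrightarrow> Chebyshev_radius C B \<le> r"
    and Chebyshev_radius_nonneg: "0 \<le> Chebyshev_radius C B"
    and near_centres_above_Chebyshev_radius: "Chebyshev_radius C B < r \<Longrightarrow> near_centres C B r \<noteq> {}"
proof -
  have nonneg: "0 \<le> r" if "near_centres C B r \<noteq> {}" for r
    using that assms(2) by (auto simp: near_centres_def) (meson norm_ge_zero order_trans all_not_in_conv)
  have bdd: "bdd_below {r. near_centres C B r \<noteq> {}}" using nonneg by (intro bdd_belowI[of _ 0]) simp
  show "near_centres C B r \<noteq> {} \<Longrightarrow> Chebyshev_radius C B \<le> r"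
    unfolding Chebyshev_radius_def using bdd by (intro cInf_lower) simp
  show "0 \<le> Chebyshev_radius C B"
    unfolding Chebyshev_radius_def using assms(1) nonneg by (intro cInf_greatest) auto
  assume "Chebyshev_radius C B < r"
  then obtain r' where r': "near_centres C B r' \<noteq> {}" "r' < r"
    using cInf_less_iff[OF _ bdd] assms(1) unfolding Chebyshev_radius_def by auto
  moreover have "near_centres C B r' \<subseteq> near_centres C B r" using r'(2) by (force simp: near_centres_def)
  ultimately show "near_centres C B r \<noteq> {}" by blast
qed

theorem L_embedded_Chebyshev_centre:
  fixes C B :: "'a::banach set"
  assumes L: "L_embedded C" and B: "B \<subseteq> C" "B \<noteq> {}" "bounded B"
  defines "W \<equiv> near_centres C B (Chebyshev_radius C B)"
  shows "W \<noteq> {}" "compactin weak_topology W"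
proof -
  define r where "r = Chebyshev_radius C B"
  obtain Es :: "'a bidual set" where Es: "subspace Es"
    and Es_norm: "\<And>x \<xi>. \<xi> \<in> Es \<Longrightarrow> norm (canonical_embedding x + \<xi>) = norm x + norm \<xi>"
    and Es_closure: "\<And>u. u \<in> weak_star_topology closure_of (canonical_embedding ` C) \<Longrightarrow>
            \<exists>c\<in>C. \<exists>\<xi>\<in>Es. u = canonical_embedding c + \<xi>"
    using L unfolding L_embedded_def by blast
  obtain b0 where b0: "b0 \<in> B" using B by auto
  obtain M where M: "\<And>b. b \<in> B \<Longrightarrow> norm b \<le> M" using B(3) unfolding bounded_iff by blast
  have "norm (b0 - b) \<le> M + M" if "b \<in> B" for b
    using M[OF that] M[OF b0] norm_triangle_ineq4[of b0 b] by linarith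
  then have ne0: "near_centres C B (M + M) \<noteq> {}" using b0 B(1) by (auto simp: near_centres_def)
  note r_le = Chebyshev_radius_le[OF ne0 B(2), folded r_def]
  note r_nonneg = Chebyshev_radius_nonneg[OF ne0 B(2), folded r_def]
  note above = near_centres_above_Chebyshev_radius[OF ne0 B(2), folded r_def]
  have norm_within: "norm c \<le> M + q" if "c \<in> near_centres C B q" for c q
  proof -
    have "norm (c - b0) \<le> q" using that b0 by (simp add: near_centres_def)
    then show ?thesis using M[OF b0] norm_triangle_sub[of c b0] by linarith
  qed
  \<comment> \<open>This is used twice: for a \<open>g\<close> found by compactness it makes
    \<open>W\<close> nonempty, and for limits of the image of \<open>W\<close> it makes that image
    closed.\<close>
  have key: "g \<in> weak_eval ` W"
    if g: "\<And>d. 0 < d \<Longrightarrow> g \<in> closure (weak_eval ` near_centres C B (r + d))" for g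
  proof -
    have *: "\<exists>u :: 'a bidual. blinfun_apply u = g \<and>
           u \<in> weak_star_topology closure_of (canonical_embedding ` near_centres C B (r + d))" if "0 < d" for d
      by (rule weak_eval_closure_imp_bidual[OF norm_within g[OF that]])
    \<comment> \<open>The choice does not involve \<open>d\<close>, so one and the same
      \<open>u\<close> lies in the closures for all \<open>d\<close>.\<close>
    define u where "u = Blinfun g"
    have u: "blinfun_apply u = g"
      "u \<in> weak_star_topology closure_of (canonical_embedding ` near_centres C B (r + d))" if "0 < d" for d
      using *[OF that] unfolding u_def by (metis blinfun_apply_inverse)+
    have "u \<in> weak_star_topology closure_of (canonical_embedding ` C)"
      using u(2)[of 1] closure_of_mono[of "canonical_embedding ` near_centres C B (r + 1)" "canonical_embedding ` C"]
      by (auto simp: near_centres_def)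
    then obtain c \<xi> where c: "c \<in> C" "\<xi> \<in> Es" "u = canonical_embedding c + \<xi>"
      using Es_closure by blast
    have near: "norm (c - b) \<le> r - norm \<xi>" if "b \<in> B" for b
    proof -
      have "norm (u - canonical_embedding b) \<le> r + d" if "0 < d" for d
        using norm_weak_star_closure_le[OF u(2)[OF that], of b "r + d"] r_nonneg \<open>b \<in> B\<close> that
        by (simp add: near_centres_def)
      then have "norm (u - canonical_embedding b) \<le> r" by (rule field_le_epsilon)
      moreover have "u - canonical_embedding b = canonical_embedding (c - b) + \<xi>"
        unfolding c(3) by (rule blinfun_eqI) (simp add: blinfun.diff_left blinfun.add_left blinfun.diff_right)
      ultimately show ?thesis using Es_norm[OF c(2), of "c - b"] by simp
    qed
    then have "near_centres C B (r - norm \<xi>) \<noteq> {}" using c(1) by (auto simp: near_centres_def)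
    \<comment> \<open>Norm additivity has made \<open>r - norm \<xi>\<close> an admissible radius,
      and no admissible radius is below \<open>r\<close>.\<close>
    then have "norm \<xi> \<le> 0" using r_le by fastforce
    then have "g = weak_eval c" "c \<in> W"
      using u(1)[of 1] c near by (auto simp: W_def near_centres_def r_def weak_eval_def fun_eq_iff)
    then show ?thesis by blast
  qed
  define Box where "Box = {g :: 'a dual \<Rightarrow> real. \<forall>f. \<bar>g f\<bar> \<le> norm f * (M + (r + 1))}"
  have Box: "compact Box" unfolding Box_def by (rule compact_dual_box)
  have in_Box: "weak_eval ` near_centres C B q \<subseteq> Box" if "q \<le> r + 1" for q
  proof clarify
    fix c assume c: "c \<in> near_centres C B q"
    have "\<bar>blinfun_apply f c\<bar> \<le> norm f * (M + (r + 1))" for f :: "'a dual"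
      using norm_blinfun[of f c] norm_within[OF c] that
        mult_left_mono[of "norm c" "M + (r + 1)" "norm f"] by simp
    then show "weak_eval c \<in> Box" by (simp add: Box_def weak_eval_def)
  qed
  \<comment> \<open>The radii \<open>r + 1 / Suc n\<close> decrease to \<open>r\<close> and never
    exceed \<open>r + 1\<close>, so all these images lie in the compact \<open>Box\<close>.\<close>
  have "Box \<inter> (\<Inter>n::nat. closure (weak_eval ` near_centres C B (r + 1 / Suc n))) \<noteq> {}"
  proof (rule compact_imp_fip_image[OF Box])
    fix I :: "nat set" assume "finite I"
    then obtain N where N: "\<And>n. n \<in> I \<Longrightarrow> n \<le> N" using finite_nat_set_iff_bounded_le by auto
    obtain c where c: "c \<in> near_centres C B (r + 1 / Suc N)" using above[of "r + 1 / Suc N"] by auto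
    have "weak_eval c \<in> closure (weak_eval ` near_centres C B (r + 1 / Suc n))" if "n \<in> I" for n
    proof -
      have "1 / real (Suc N) \<le> 1 / real (Suc n)" using N[OF that] by (simp add: frac_le)
      then have "c \<in> near_centres C B (r + 1 / Suc n)" using c by (fastforce simp: near_centres_def)
      then show ?thesis by (intro subsetD[OF closure_subset] imageI)
    qed
    moreover have "weak_eval c \<in> Box" using in_Box[of "r + 1 / Suc N"] c by auto
    ultimately show "Box \<inter> (\<Inter>n\<in>I. closure (weak_eval ` near_centres C B (r + 1 / Suc n))) \<noteq> {}" by blast
  qed auto
  then obtain g where g: "\<And>n::nat. g \<in> closure (weak_eval ` near_centres C B (r + 1 / Suc n))" by blast
  have mono: "closure (weak_eval ` near_centres C B q) \<subseteq> closure (weak_eval ` near_centres C B q')" if "q \<le> q'" for q q'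
    using that by (intro closure_mono image_mono) (force simp: near_centres_def)
  have "g \<in> closure (weak_eval ` near_centres C B (r + d))" if "0 < d" for d
  proof -
    obtain n :: nat where "1 / Suc n < d" using \<open>0 < d\<close> nat_approx_posE by auto
    then show ?thesis using g[of n] mono[of "r + 1 / Suc n" "r + d"] by auto
  qed
  then show "W \<noteq> {}" using key by blast
  have "closure (weak_eval ` W) \<subseteq> weak_eval ` W"
  proof
    fix h assume h: "h \<in> closure (weak_eval ` W)"
    show "h \<in> weak_eval ` W"
    proof (rule key)
      fix d :: real assume "0 < d"
      then show "h \<in> closure (weak_eval ` near_centres C B (r + d))"
        using subsetD[OF mono[of r "r + d"]] h by (simp add: W_def r_def)
    qed
  qed
  then have "closed (weak_eval ` W)" using closure_subset_eq by blast
  moreover have "weak_eval ` W \<subseteq> Box" using in_Box[of r] by (simp add: W_def r_def)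
  ultimately have "compact (weak_eval ` W)"
    using Box by (metis compact_Int_closed inf.absorb_iff2)
  then show "compactin weak_topology W" by (rule compactin_weak_topology_if_compact_eval)
qed

section \<open>Common fixed points\<close>

definition closed_under :: "('a \<Rightarrow> 'a \<Rightarrow> 'a) set \<Rightarrow> 'a set \<Rightarrow> bool" where
  "closed_under ops D \<longleftrightarrow> (\<forall>f\<in>ops. \<forall>x\<in>D. \<forall>y\<in>D. f x y \<in> D)"

text \<open>The closure is the union of countably many increasing stages, each of them countable.
  Unary maps will enter as operations that ignore their second argument.\<close>

lemma countable_closed_under_operations:
  assumes "countable A" "countable ops"
  obtains D where "countable D" "A \<subseteq> D" "closed_under ops D"
    "\<forall>E. A \<subseteq> E \<longrightarrow> closed_under ops E \<longrightarrow> D \<subseteq> E"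
proof -
  define G where "G = (\<lambda>D. D \<union> (\<lambda>(f, x, y). f x y) ` (ops \<times> D \<times> D))"
  define D where "D = (\<lambda>n. (G ^^ n) A)"
  have D_Suc: "D (Suc n) = D n \<union> (\<lambda>(f, x, y). f x y) ` (ops \<times> D n \<times> D n)" for n
    by (simp add: D_def G_def)
  have mono: "mono D" unfolding mono_iff_le_Suc by (simp add: D_Suc)
  have "countable (D n)" for n
  proof (induction n)
    case 0
    then show ?case using assms(1) by (simp add: D_def)
  next
    case (Suc n)
    then show ?case unfolding D_Suc using assms(2) by (intro countable_Un countable_image countable_SIGMA)
  qed
  then have "countable (\<Union>n. D n)" by simp
  moreover have "A \<subseteq> (\<Union>n. D n)" by (rule order_trans[OF _ UN_upper[of 0]]) (simp_all add: D_def)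
  moreover have "closed_under ops (\<Union>n. D n)"
    unfolding closed_under_def
  proof (intro ballI)
    fix f x y assume f: "f \<in> ops" and xy: "x \<in> (\<Union>n. D n)" "y \<in> (\<Union>n. D n)"
    obtain m n where "x \<in> D m" "y \<in> D n" using xy by auto
    then have "x \<in> D (max m n)" "y \<in> D (max m n)"
      using monoD[OF mono, of m "max m n"] monoD[OF mono, of n "max m n"] by auto
    then have "f x y \<in> D (Suc (max m n))" unfolding D_Suc using f by force
    then show "f x y \<in> (\<Union>n. D n)" by blast
  qed
  moreover have "\<forall>E. A \<subseteq> E \<longrightarrow> closed_under ops E \<longrightarrow> (\<Union>n. D n) \<subseteq> E"
  proof (intro allI impI)
    fix E assume E: "A \<subseteq> E" "closed_under ops E"
    have "D n \<subseteq> E" for n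
    proof (induction n)
      case 0
      then show ?case using E(1) by (simp add: D_def)
    next
      case (Suc n)
      then show ?case unfolding D_Suc using E(2) by (auto simp: closed_under_def subset_iff)
    qed
    then show "(\<Union>n. D n) \<subseteq> E" by auto
  qed
  ultimately show ?thesis by (rule that)
qed

lemma closedin_weak_topology_imp_closed:
  assumes "closedin weak_topology (A :: 'a::real_normed_vector set)"
  shows "closed A"
proof -
  have "continuous_map euclidean (weak_topology :: 'a topology) (\<lambda>x. x)"
    unfolding continuous_map_weak_topology_iff
    by (simp add: blinfun.bounded_linear_right linear_continuous_on)
  from closedin_continuous_map_preimage[OF this assms] show ?thesis by simp
qed

text \<open>For each \<open>z\<close> in \<open>Y\<close> some point of a finite net is within
  \<open>d/2\<close> of \<open>z\<close> and the others are within \<open>d\<close>, so the average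
  of the \<open>n\<close> net points gains \<open>d / (2 * n)\<close>.\<close>

lemma compact_nondiametral_point:
  fixes Y :: "'a::real_normed_vector set"
  assumes Y: "compact Y" "Y \<subseteq> K" "x \<in> Y" "y \<in> Y" "x \<noteq> y" and "convex K"
  obtains u r where "u \<in> K" "r < diameter Y" "\<forall>z\<in>Y. norm (u - z) \<le> r"
proof -
  define d where "d = diameter Y"
  have le_d: "norm (a - b) \<le> d" if "a \<in> Y" "b \<in> Y" for a b
    using diameter_bounded_bound[OF compact_imp_bounded[OF Y(1)] that] by (simp add: d_def dist_norm)
  have "0 < norm (x - y)" using Y(5) by simp
  then have "0 < d" using le_d[OF Y(3,4)] by linarith
  have "Y \<subseteq> (\<Union>q\<in>Y. ball q (d/2))" using \<open>0 < d\<close> by force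
  then obtain Q where Q: "Q \<subseteq> Y" "finite Q" "Y \<subseteq> (\<Union>q\<in>Q. ball q (d/2))"
    using compactE_image[OF Y(1), of Y "\<lambda>q. ball q (d/2)"] by auto
  define n where "n = real (card Q)"
  have "Q \<noteq> {}" using Q(3) Y(3) by auto
  then have "0 < n" using Q(2) by (simp add: n_def card_gt_0_iff)
  define u where "u = (\<Sum>q\<in>Q. (1/n) *\<^sub>R q)"
  have "u \<in> K"
    unfolding u_def using Q(1,2) Y(2) \<open>0 < n\<close> by (intro convex_sum[OF _ \<open>convex K\<close>]) (auto simp: n_def)
  moreover have "d - d / (2 * n) < diameter Y" using \<open>0 < d\<close> \<open>0 < n\<close> by (simp add: d_def)
  moreover have "norm (u - z) \<le> d - d / (2 * n)" if z: "z \<in> Y" for z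
  proof -
    obtain q0 where q0: "q0 \<in> Q" "norm (q0 - z) < d/2" using Q(3) z by (auto simp: dist_norm)
    have "u - z = (\<Sum>q\<in>Q. (1/n) *\<^sub>R (q - z))"
      using \<open>0 < n\<close> by (simp add: u_def scaleR_diff_right sum_subtractf n_def sum_constant_scaleR)
    then have "norm (u - z) \<le> (\<Sum>q\<in>Q. (1/n) * norm (q - z))"
      using norm_sum[of "\<lambda>q. (1/n) *\<^sub>R (q - z)" Q] \<open>0 < n\<close> by simp
    also have "\<dots> \<le> (\<Sum>q\<in>Q. (1/n) * (d - (if q = q0 then d/2 else 0)))"
      using q0 le_d Q(1) z \<open>0 < n\<close> by (intro sum_mono mult_left_mono) auto
    also have "\<dots> = (1/n) * (n * d - d/2)"
      unfolding sum_distrib_left[symmetric] using q0(1) Q(2) by (simp add: sum_subtractf n_def)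
    also have "\<dots> = d - d / (2 * n)" using \<open>0 < n\<close> by (simp add: field_simps)
    finally show ?thesis .
  qed
  ultimately show ?thesis using that[of u "d - d / (2 * n)"] by blast
qed

text \<open>\<open>D\<close> is generated from one point by the maps and by convex combinations with
  weights from a countable dense set. Continuity extends invariance to the closure and provides the
  remaining weights.\<close>

lemma separable_convex_invariant_subset:
  fixes W :: "'a::real_normed_vector set"
  assumes W: "convex W" "closed W" "x0 \<in> W" and "countable S"
    and T_mem: "\<And>s x. s \<in> S \<Longrightarrow> x \<in> W \<Longrightarrow> T s x \<in> W"
    and cont: "\<And>s. s \<in> S \<Longrightarrow> continuous_on W (T s)"
  obtains D where "countable D" "D \<noteq> {}" "closure D \<subseteq> W" "convex (closure D)"
    "\<forall>s\<in>S. T s ` closure D \<subseteq> closure D"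
proof -
  obtain Q :: "real set" where Q: "countable Q" "Q \<subseteq> {0..1}" "{0..1} \<subseteq> closure Q"
    by (rule separable)
  define ops where "ops = (\<lambda>s x y. T s x) ` S \<union> (\<lambda>t x y. (1 - t) *\<^sub>R x + t *\<^sub>R y) ` Q"
  have "countable ops" unfolding ops_def using Q(1) \<open>countable S\<close> by blast
  then obtain D where D: "countable D" "{x0} \<subseteq> D" and D_closed: "closed_under ops D"
    and least: "\<forall>E. {x0} \<subseteq> E \<longrightarrow> closed_under ops E \<longrightarrow> D \<subseteq> E"
    using countable_closed_under_operations[of "{x0}" ops] by auto
  have ops: "f x y \<in> D" if "f \<in> ops" "x \<in> D" "y \<in> D" for f x y
    using D_closed that by (simp add: closed_under_def)
  have "closed_under ops W"
    unfolding closed_under_def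
  proof (intro ballI)
    fix f x y assume f: "f \<in> ops" and xy: "x \<in> W" "y \<in> W"
    from f consider s where "s \<in> S" "f = (\<lambda>x y. T s x)"
      | t where "t \<in> Q" "f = (\<lambda>x y. (1 - t) *\<^sub>R x + t *\<^sub>R y)"
      unfolding ops_def by blast
    then show "f x y \<in> W"
    proof cases
      case 1
      then show ?thesis using T_mem xy by simp
    next
      case 2
      then show ?thesis using xy Q(2) convexD_alt[OF W(1)] by auto
    qed
  qed
  then have "D \<subseteq> W" using least W(3) by simp
  then have sub: "closure D \<subseteq> W" using W(2) by (rule closure_minimal)
  have "convex (closure D)"
    unfolding convex_alt
  proof (intro ballI allI impI)
    fix x y and t :: real assume xy: "x \<in> closure D" "y \<in> closure D" and t: "0 \<le> t \<and> t \<le> 1"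
    define \<phi> where "\<phi> = (\<lambda>p :: real \<times> 'a \<times> 'a. (1 - fst p) *\<^sub>R fst (snd p) + fst p *\<^sub>R snd (snd p))"
    have "continuous_on (closure (Q \<times> D \<times> D)) \<phi>" unfolding \<phi>_def by (intro continuous_intros)
    moreover have "\<phi> ` (Q \<times> D \<times> D) \<subseteq> closure D"
    proof clarify
      fix t a b assume "t \<in> Q" "a \<in> D" "b \<in> D"
      then have "(1 - t) *\<^sub>R a + t *\<^sub>R b \<in> D"
        using ops[of "\<lambda>x y. (1 - t) *\<^sub>R x + t *\<^sub>R y" a b] by (auto simp: ops_def)
      then show "\<phi> (t, a, b) \<in> closure D" using closure_subset by (auto simp: \<phi>_def)
    qed
    ultimately have "\<phi> ` closure (Q \<times> D \<times> D) \<subseteq> closure D"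
      by (intro image_closure_subset) auto
    moreover have "(t, x, y) \<in> closure (Q \<times> D \<times> D)"
      using xy t Q(3) by (auto simp: closure_Times)
    ultimately have "\<phi> (t, x, y) \<in> closure D" by blast
    then show "(1 - t) *\<^sub>R x + t *\<^sub>R y \<in> closure D" by (simp add: \<phi>_def)
  qed
  moreover have "T s ` closure D \<subseteq> closure D" if s: "s \<in> S" for s
  proof (rule image_closure_subset)
    show "continuous_on (closure D) (T s)" using cont[OF s] sub by (rule continuous_on_subset)
    have "T s x \<in> D" if "x \<in> D" for x
      using ops[of "\<lambda>x y. T s x" x x] s that by (auto simp: ops_def)
    then show "T s ` D \<subseteq> closure D" using closure_subset by auto
  qed simp
  ultimately show ?thesis using that[of D] D sub by auto
qed

section \<open>Fixed points on weakly compact convex sets\<close>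

theorem weakly_compact_common_fixed_point_countable:
  fixes W :: "'a::banach set" and T :: "'s::semigroup_mult \<Rightarrow> 'a \<Rightarrow> 'a"
  assumes W: "compactin weak_topology W" "convex W" "W \<noteq> {}"
    and S: "countable S" "S \<noteq> {}" "\<And>s t. s \<in> S \<Longrightarrow> t \<in> S \<Longrightarrow> s * t \<in> S"
      "\<And>s t. s \<in> S \<Longrightarrow> t \<in> S \<Longrightarrow> \<exists>u\<in>S. \<exists>v\<in>S. s * u = t * v"
    and T_mult: "\<And>s t x. s \<in> S \<Longrightarrow> t \<in> S \<Longrightarrow> x \<in> W \<Longrightarrow> T (s * t) x = T s (T t x)"
    and T_cont: "\<And>s. s \<in> S \<Longrightarrow>
       continuous_map (subtopology weak_topology W) (subtopology weak_topology W) (T s)"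
    and T_nonexp: "\<And>s x y. s \<in> S \<Longrightarrow> x \<in> W \<Longrightarrow> y \<in> W \<Longrightarrow> norm (T s x - T s y) \<le> norm (x - y)"
  shows "\<exists>x\<in>W. \<forall>s\<in>S. T s x = x"
proof -
  have T_mem: "T s x \<in> W" if "s \<in> S" "x \<in> W" for s x
    using continuous_map_image_subset_topspace[OF T_cont[OF that(1)]] that(2) by auto
  have W_closedin: "closedin weak_topology W"
    using Hausdorff_space_weak_topology W(1) by (rule compactin_imp_closedin)
  have cont: "continuous_on W (T s)" if s: "s \<in> S" for s
    unfolding continuous_on_iff
  proof (intro ballI allI impI)
    fix x and e :: real assume "x \<in> W" "0 < e"
    then show "\<exists>d>0. \<forall>y\<in>W. dist y x < d \<longrightarrow> dist (T s y) (T s x) < e"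
      using T_nonexp[OF s] by (intro exI[of _ e]) (auto simp: dist_norm intro: le_less_trans)
  qed
  obtain x0 where "x0 \<in> W" using W(3) by auto
  obtain D where D: "countable D" "D \<noteq> {}" "closure D \<subseteq> W" "convex (closure D)"
    and D_inv: "\<forall>s\<in>S. T s ` closure D \<subseteq> closure D"
    using separable_convex_invariant_subset
      [where T = T, OF W(2) closedin_weak_topology_imp_closed[OF W_closedin] \<open>x0 \<in> W\<close> S(1) T_mem cont] by metis
  \<comment> \<open>Minimal sets are sought inside \<open>closure D\<close>, so that
    \<open>K\<close> is norm separable.\<close>
  define \<A> where "\<A> = {K. K \<noteq> {} \<and> convex K \<and> closedin weak_topology K \<and> K \<subseteq> closure D \<and>
      (\<forall>s\<in>S. T s ` K \<subseteq> K)}"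
  have compact_W: "compact_space (subtopology weak_topology W)"
    using W(1) by (rule compact_space_subtopology)
  have "\<exists>K\<in>\<A>. \<forall>N\<in>\<A>. N \<subseteq> K \<longrightarrow> N = K"
  proof (rule Zorn_minimal_set)
    have "closure D \<in> \<A>"
      using D D_inv by (simp add: \<A>_def closedin_weak_topology_convex)
    then show "\<A> \<noteq> {}" by auto
  next
    fix \<C> assume ne: "\<C> \<noteq> {}" and chain: "subset.chain \<A> \<C>"
    then have sub: "C \<in> \<A>" if "C \<in> \<C>" for C using that by (auto simp: subset_chain_def)
    have "\<Inter>\<C> \<noteq> {}"
    proof (rule compact_space_directed_Inter_nonempty[OF compact_W ne])
      fix C assume "C \<in> \<C>"
      note C = sub[OF this]
      show "C \<noteq> {}" using C by (simp add: \<A>_def)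
      show "closedin (subtopology weak_topology W) C"
        using C D(3) by (intro closedin_subset_topspace) (auto simp: \<A>_def)
    qed (rule chain_directed[OF chain])
    moreover have "convex (\<Inter>\<C>)" using sub by (intro convex_Inter) (simp add: \<A>_def)
    moreover have "closedin weak_topology (\<Inter>\<C>)"
      using ne sub by (intro closedin_Inter) (simp_all add: \<A>_def)
    moreover obtain C0 where "C0 \<in> \<C>" using ne by auto
    then have "\<Inter>\<C> \<subseteq> closure D" using sub[of C0] by (auto simp: \<A>_def)
    moreover have "T s ` \<Inter>\<C> \<subseteq> \<Inter>\<C>" if s: "s \<in> S" for s
    proof (clarify)
      fix x C assume "x \<in> \<Inter>\<C>" "C \<in> \<C>"
      then have "x \<in> C" "T s ` C \<subseteq> C" using sub[OF \<open>C \<in> \<C>\<close>] s by (simp_all add: \<A>_def)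
      then show "T s x \<in> C" by auto
    qed
    ultimately show "\<Inter>\<C> \<in> \<A>" by (simp add: \<A>_def)
  qed
  then obtain K where K: "K \<in> \<A>" and minimal: "\<forall>N\<in>\<A>. N \<subseteq> K \<longrightarrow> N = K" ..
  have K_ne: "K \<noteq> {}" and K_convex: "convex K" and K_closedin: "closedin weak_topology K"
    and K_D: "K \<subseteq> closure D" and K_inv: "\<And>s. s \<in> S \<Longrightarrow> T s ` K \<subseteq> K"
    using K by (auto simp: \<A>_def)
  have KW: "K \<subseteq> W" using K_D D(3) by (rule order_trans)
  have topK: "topspace (subtopology weak_topology K) = K" by simp
  interpret nonexpansive_flow "subtopology weak_topology K" S T
  proof (unfold_locales, unfold topK)
    have "compactin weak_topology K" using W(1) KW K_closedin by (rule closed_compactin)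
    then show "compact_space (subtopology weak_topology K)" by (rule compact_space_subtopology)
    show "Hausdorff_space (subtopology weak_topology K)"
      using Hausdorff_space_weak_topology by (rule Hausdorff_space_subtopology)
    show "K \<noteq> {}" by (rule K_ne)
    show "closed K" using K_closedin by (rule closedin_weak_topology_imp_closed)
    show "closedin (subtopology weak_topology K) (K \<inter> cball q e)" for q e
      using closedin_weak_topology_convex[OF convex_cball closed_cball, of q e]
      unfolding closedin_subtopology by (intro exI[of _ "cball q e"]) auto
    show "\<exists>Q. countable Q \<and> K \<subseteq> closure Q" using D(1) K_D by auto
    show "S \<noteq> {}" by (rule S)
    fix s assume s: "s \<in> S"
    have "continuous_map (subtopology weak_topology K) (subtopology weak_topology W) (T s)"
      using T_cont[OF s] KW by (rule continuous_map_from_subtopology_mono)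
    then show "continuous_map (subtopology weak_topology K) (subtopology weak_topology K) (T s)"
      using K_inv[OF s] by (auto simp: continuous_map_in_subtopology)
    show "dist (T s x) (T s y) \<le> dist x y" if "x \<in> K" "y \<in> K" for x y
      using T_nonexp[OF s] that KW by (auto simp: dist_norm)
    fix t assume t: "t \<in> S"
    show "s * t \<in> S" "\<exists>u\<in>S. \<exists>v\<in>S. s * u = t * v" using S s t by auto
    show "T (s * t) x = T s (T t x)" if "x \<in> K" for x using T_mult s t that KW by auto
  qed
  obtain Y where Y: "compact Y" "Y \<noteq> {}" "Y \<subseteq> K" and "\<forall>s\<in>S. T s ` Y = Y"
    using exists_compact_fixed_set unfolding topK by metis
  then have Y_inv: "T s ` Y = Y" if "s \<in> S" for s using that by simp
  obtain y where y: "y \<in> Y" using Y(2) by auto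
  have "z = y" if z: "z \<in> Y" for z
  proof (rule ccontr)
    assume "z \<noteq> y"
    obtain u r where u: "u \<in> K" "r < diameter Y" "\<forall>x\<in>Y. norm (u - x) \<le> r"
      using compact_nondiametral_point[OF Y(1,3) z y \<open>z \<noteq> y\<close> K_convex] by metis
    \<comment> \<open>Since \<open>u\<close> lies in \<open>K'\<close>, minimality will force
      \<open>K' = K\<close>. Then any two points of \<open>Y\<close> are within \<open>r\<close> of
      each other, although \<open>r\<close> is below the diameter.\<close>
    define K' where "K' = K \<inter> (\<Inter>x\<in>Y. cball x r)"
    have "u \<in> K'" using u by (auto simp: K'_def dist_norm norm_minus_commute)
    moreover have "convex K'" unfolding K'_def by (intro convex_Int K_convex convex_INT) auto
    moreover have "closedin weak_topology K'"
      unfolding K'_def using Y(2)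
      by (intro closedin_Int K_closedin closedin_INT closedin_weak_topology_convex) auto
    moreover have "T s ` K' \<subseteq> K'" if s: "s \<in> S" for s
    proof clarify
      fix x assume x: "x \<in> K'"
      then have xK: "x \<in> K" by (simp add: K'_def)
      have "dist a (T s x) \<le> r" if a: "a \<in> Y" for a
      proof -
        \<comment> \<open>Surjectivity of \<open>T s\<close> on \<open>Y\<close> is what lets
          nonexpansiveness compare \<open>T s x\<close> with an arbitrary \<open>a\<close> in
          \<open>Y\<close>.\<close>
        obtain b where b: "b \<in> Y" "a = T s b" using Y_inv[OF s] a by blast
        have "dist b x \<le> r" using x b(1) by (simp add: K'_def)
        then show ?thesis
          using T_nonexpansive[OF s, of b x] b Y(3) xK by (auto simp: subset_iff)
      qed
      then show "T s x \<in> K'" using K_inv[OF s] xK by (auto simp: K'_def)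
    qed
    ultimately have "K' \<in> \<A>" using K_D by (auto simp: \<A>_def K'_def)
    then have "K' = K" using bspec[OF minimal] by (simp add: K'_def)
    then have "norm (a - b) \<le> r" if "a \<in> Y" "b \<in> Y" for a b
    proof -
      have "b \<in> K'" using that Y(3) \<open>K' = K\<close> by auto
      then show ?thesis using that by (simp add: K'_def dist_norm)
    qed
    then have "diameter Y \<le> r" using Y(2) by (intro diameter_le) auto
    then show False using u(2) by simp
  qed
  then have "Y = {y}" using y by blast
  then have "T s y = y" if "s \<in> S" for s using Y_inv[OF that] by simp
  moreover have "y \<in> W" using y Y(3) KW by auto
  ultimately show ?thesis by blast
qed

text \<open>The fixed point sets are weakly closed, so by compactness it suffices that finitely many
  of them meet; finitely many elements lie in a countable left reversible subsemigroup.\<close>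

theorem weakly_compact_common_fixed_point:
  fixes W :: "'a::banach set" and T :: "'s::semigroup_mult \<Rightarrow> 'a \<Rightarrow> 'a"
  assumes reversible: "left_reversible TYPE('s)"
    and W: "compactin weak_topology W" "convex W" "W \<noteq> {}"
    and T_mult: "\<And>s t x. x \<in> W \<Longrightarrow> T (s * t) x = T s (T t x)"
    and T_cont: "\<And>s. continuous_map (subtopology weak_topology W) (subtopology weak_topology W) (T s)"
    and T_nonexp: "\<And>s x y. x \<in> W \<Longrightarrow> y \<in> W \<Longrightarrow> norm (T s x - T s y) \<le> norm (x - y)"
  shows "\<exists>x\<in>W. \<forall>s. T s x = x"
proof -
  have "\<exists>u v. s * u = t * v" for s t :: 's
    using reversible unfolding left_reversible_def by (metis disjoint_iff rangeE)
  \<comment> \<open>As choice functions, the witnesses of reversibility become binary operations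
    under which a countable set can be closed.\<close>
  then obtain u v where uv: "\<And>s t :: 's. s * u s t = t * v s t" by metis
  define X where "X = subtopology weak_topology W"
  have topX: "topspace X = W" by (simp add: X_def)
  define Fix where "Fix = (\<lambda>s. {x \<in> topspace X. T s x = x})"
  have closed: "closedin X (Fix s)" for s
    unfolding Fix_def X_def
    by (rule closedin_continuous_maps_eq[OF Hausdorff_space_subtopology[OF Hausdorff_space_weak_topology, of W]
          T_cont]) simp
  have "\<Inter>\<F> \<noteq> {}" if \<F>: "finite \<F>" "\<F> \<subseteq> range Fix" for \<F>
  proof -
    obtain A where A: "finite A" "\<F> = Fix ` A" using finite_subset_image[OF \<F>] by auto
    \<comment> \<open>The element \<open>undefined\<close> keeps \<open>S\<close> nonempty when
      \<open>A\<close> is empty.\<close>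
    have "countable (insert undefined A)" "countable {(*), u, v}"
      using A(1) by (simp_all add: countable_finite)
    then obtain S where S: "countable S" "insert undefined A \<subseteq> S" and S_closed: "closed_under {(*), u, v} S"
      by (rule countable_closed_under_operations)
    have "\<exists>x\<in>W. \<forall>s\<in>S. T s x = x"
    proof (rule weakly_compact_common_fixed_point_countable[OF W S(1)])
      show "S \<noteq> {}" using S(2) by auto
      fix s t assume st: "s \<in> S" "t \<in> S"
      show "s * t \<in> S" using S_closed st by (simp add: closed_under_def)
      have "u s t \<in> S" "v s t \<in> S" using S_closed st by (simp_all add: closed_under_def)
      then show "\<exists>u\<in>S. \<exists>v\<in>S. s * u = t * v" using uv[of s t] by auto
    qed (use T_mult T_cont T_nonexp in auto)
    then obtain x where "x \<in> W" "\<And>s. s \<in> S \<Longrightarrow> T s x = x" by auto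
    then have "x \<in> \<Inter>\<F>" using A(2) S(2) by (auto simp: Fix_def topX)
    then show ?thesis by auto
  qed
  moreover have "compact_space X" unfolding X_def using W(1) by (rule compact_space_subtopology)
  ultimately have "\<Inter>(range Fix) \<noteq> {}"
    using closed compact_space_fip[THEN iffD1, rule_format, of X "range Fix"] by auto
  then show ?thesis by (auto simp: Fix_def topX)
qed

section \<open>Fixed points in L-embedded convex sets\<close>

theorem theorem3p10:
  fixes C B :: "'a::banach set"
    and T :: "'s::semigroup_mult \<Rightarrow> 'a \<Rightarrow> 'a"
  assumes "left_reversible TYPE('s)"
    and "C \<noteq> {}" and "L_embedded C" and "convex C"
    and "representation_on T C"
    and "norm_nonexpansive_on T C"
    and "\<And>M s. M \<subseteq> C \<Longrightarrow> compactin weak_topology M \<Longrightarrow> S_invariant T M \<Longrightarrow> convex M \<Longrightarrow>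
           continuous_map (subtopology weak_topology M) (subtopology weak_topology M) (T s)"
    and "B \<subseteq> C" and "B \<noteq> {}" and "bounded B"
    and "\<And>s. T s ` B = B"
  shows "\<exists>x\<in>C. \<forall>s. T s x = x"
proof -
  define W where "W = near_centres C B (Chebyshev_radius C B)"
  have W: "W \<noteq> {}" "compactin weak_topology W"
    unfolding W_def using L_embedded_Chebyshev_centre[OF assms(3,8,9,10)] by auto
  have WC: "W \<subseteq> C" by (auto simp: W_def near_centres_def)
  have "W = C \<inter> (\<Inter>b\<in>B. cball b (Chebyshev_radius C B))"
    by (auto simp: W_def near_centres_def dist_norm norm_minus_commute)
  then have "convex W" using assms(4) by (auto intro!: convex_Int convex_INT)
  have inv: "S_invariant T W"
    unfolding S_invariant_def
  proof (intro allI, clarify)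
    fix s x assume x: "x \<in> W"
    have "norm (T s x - b) \<le> Chebyshev_radius C B" if b: "b \<in> B" for b
    proof -
      \<comment> \<open>As \<open>T s\<close> maps \<open>B\<close> onto \<open>B\<close>, every
        \<open>b\<close> is the image of some \<open>b'\<close>, and the distance from
        \<open>x\<close> to \<open>b'\<close> bounds the one from \<open>T s x\<close> to
        \<open>b\<close>.\<close>
      obtain b' where b': "b' \<in> B" "b = T s b'" using assms(11)[of s] b by blast
      have "norm (T s x - T s b') \<le> norm (x - b')"
        using assms(6) x WC b' assms(8) unfolding norm_nonexpansive_on_def by blast
      moreover have "norm (x - b') \<le> Chebyshev_radius C B"
        using x b' by (simp add: W_def near_centres_def)
      ultimately show ?thesis using b'(2) by simp
    qed
    moreover have "T s x \<in> C" using assms(5) x WC unfolding representation_on_def by blast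
    ultimately show "T s x \<in> W" by (simp add: W_def near_centres_def)
  qed
  have "\<exists>x\<in>W. \<forall>s. T s x = x"
  proof (rule weakly_compact_common_fixed_point[OF assms(1) W(2) \<open>convex W\<close> W(1)])
    show "T (s * t) x = T s (T t x)" if "x \<in> W" for s t x
      using assms(5) that WC by (auto simp: representation_on_def)
    show "continuous_map (subtopology weak_topology W) (subtopology weak_topology W) (T s)" for s
      using WC W(2) inv \<open>convex W\<close> by (rule assms(7))
    show "norm (T s x - T s y) \<le> norm (x - y)" if "x \<in> W" "y \<in> W" for s x y
      using assms(6) that WC by (auto simp: norm_nonexpansive_on_def)
  qed
  then show ?thesis using WC by blast
qed

end
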